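(* Let $X$ be a centered random vector in $\mathbb{R}^d$ with a density and with invertible covariance matrix $C$, admitting a Stein matrix $\tau_X(X)$. Let $Z$ be a centered Gaussian random vector with covariance $C$, independent of $X$. For $0<t<1$ let $X_t=\sqrt{t}\,X+\sqrt{1-t}\,Z$ and $$\mathrm{MMSE}(X,t)=E\left[(X-E[X\,|\,X_t])(X-E[X\,|\,X_t])^T\right].$$ Then, writing $A^2$ for $AA^T$ for any matrix $A$, $$Id-\frac{1}{1-t}\,\mathrm{MMSE}(X,t)\,C^{-1}=t\,C\,E\left[E\left[(Id-C^{-1}\tau_X(X))C^{-1}Z\,|\,X_t\right]^2\right],$$ so that $$J_{st}(X_t)=\frac{t}{1-t}\,\mathrm{tr}\left(Id-\frac{1}{1-t}\,\mathrm{MMSE}(X,t)\,C^{-1}\right).$$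
   Context: Vectors in $\mathbb{R}^d$ are $d\times 1$ columns, $Id$ is the $d\times d$ identity matrix, $\cdot^T$ is the transpose, $\mathrm{tr}$ the trace. The score of a random vector $X$ is the random vector $\rho_X(X)$ (a measurable function of $X$) satisfying $E[\rho_X(X)\varphi(X)]=-E[\nabla\varphi(X)]$ for all real-valued $\varphi\in C_c^\infty(\mathbb{R}^d)$. A Stein matrix of $X$ is any random $d\times d$ matrix $\tau_X(X)$ (a measurable function of $X$) satisfying $E[\tau_X(X)\nabla\varphi(X)]=E[X\varphi(X)]$ for all real-valued $\varphi\in C_c^\infty(\mathbb{R}^d)$. For a random vector $V$ with invertible covariance $B$ and score $\rho_V(V)$: $\mathcal{J}(V)=E[(\rho_V(V)+B^{-1}V)(\rho_V(V)+B^{-1}V)^T]$ and the standardised Fisher information distance is $J_{st}(V)=\mathrm{tr}(B\,\mathcal{J}(V))$.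
   Formalization: The first identity is stated when (Id − C^{-1}τ_X(X))C^{-1}Z is integrable, since the Stein matrix definition alone does not ensure that its conditional expectation given X_t exists; the formula for J_st(X_t) needs no such proviso. *)

theory Defs
  imports "HOL-Probability.Probability"
begin

definition grad :: "(real^'n \<Rightarrow> real) \<Rightarrow> real^'n \<Rightarrow> real^'n" where
  "grad \<phi> x = (\<chi> i. frechet_derivative \<phi> (at x) (axis i 1))"

(* One asks for total differentiability at each order; for all orders together this is
   the same as existence and continuity of all iterated partial derivatives. *)
primrec times_differentiable :: "nat \<Rightarrow> (real^'n \<Rightarrow> real) \<Rightarrow> bool" where
  "times_differentiable 0 \<phi> \<longleftrightarrow> True"
| "times_differentiable (Suc k) \<phi> \<longleftrightarrow>
     (\<forall>x. \<phi> differentiable (at x)) \<and> (\<forall>i. times_differentiable k (\<lambda>x. grad \<phi> x $ i))"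

definition Cc_infinity :: "(real^'n \<Rightarrow> real) set" where
  "Cc_infinity = {\<phi>. (\<forall>k. times_differentiable k \<phi>) \<and> compact (closure {x. \<phi> x \<noteq> 0})}"

(* v v^T for a column vector v *)
definition vec_sq :: "real^'n \<Rightarrow> real^'n^'n" where
  "vec_sq v = (\<chi> i j. v $ i * v $ j)"

definition covariance_matrix :: "'a measure \<Rightarrow> ('a \<Rightarrow> real^'n) \<Rightarrow> real^'n^'n" where
  "covariance_matrix M V = (\<integral>\<omega>. vec_sq (V \<omega> - (\<integral>\<omega>'. V \<omega>' \<partial>M)) \<partial>M)"

(* N(0, C) for symmetric positive definite C *)
definition gaussian_density :: "real^'n^'n \<Rightarrow> real^'n \<Rightarrow> real" where
  "gaussian_density C x =
     exp (- (x \<bullet> (matrix_inv C *v x)) / 2) / sqrt ((2 * pi) ^ CARD('n) * det C)"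

(* E[Y | V], componentwise, with respect to the sigma-algebra generated by V *)
definition vec_cond_exp ::
    "'a measure \<Rightarrow> ('a \<Rightarrow> real^'m) \<Rightarrow> ('a \<Rightarrow> real^'n) \<Rightarrow> 'a \<Rightarrow> real^'n" where
  "vec_cond_exp M V Y \<omega> =
     (\<chi> i. real_cond_exp M (vimage_algebra (space M) V borel) (\<lambda>\<omega>'. Y \<omega>' $ i) \<omega>)"

(* Integrability is required explicitly in the next two definitions, because the Bochner
   integral of a non-integrable function is 0 by convention. *)
definition is_score :: "'a measure \<Rightarrow> ('a \<Rightarrow> real^'n) \<Rightarrow> (real^'n \<Rightarrow> real^'n) \<Rightarrow> bool" where
  "is_score M V \<rho> \<longleftrightarrow> \<rho> \<in> borel_measurable borel \<and>
     (\<forall>\<phi>\<in>Cc_infinity.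
        integrable M (\<lambda>\<omega>. \<phi> (V \<omega>) *\<^sub>R \<rho> (V \<omega>)) \<and>
        (\<integral>\<omega>. \<phi> (V \<omega>) *\<^sub>R \<rho> (V \<omega>) \<partial>M) = - (\<integral>\<omega>. grad \<phi> (V \<omega>) \<partial>M))"

definition is_stein_matrix ::
    "'a measure \<Rightarrow> ('a \<Rightarrow> real^'n) \<Rightarrow> (real^'n \<Rightarrow> real^'n^'n) \<Rightarrow> bool" where
  "is_stein_matrix M X \<tau> \<longleftrightarrow> \<tau> \<in> borel_measurable borel \<and>
     (\<forall>\<phi>\<in>Cc_infinity.
        integrable M (\<lambda>\<omega>. \<tau> (X \<omega>) *v grad \<phi> (X \<omega>)) \<and>
        (\<integral>\<omega>. \<tau> (X \<omega>) *v grad \<phi> (X \<omega>) \<partial>M) = (\<integral>\<omega>. \<phi> (X \<omega>) *\<^sub>R X \<omega> \<partial>M))"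

(* The score is an explicit argument, being determined by V only up to null sets. *)
definition fisher_info_matrix ::
    "'a measure \<Rightarrow> ('a \<Rightarrow> real^'n) \<Rightarrow> (real^'n \<Rightarrow> real^'n) \<Rightarrow> real^'n^'n" where
  "fisher_info_matrix M V \<rho> =
     (\<integral>\<omega>. vec_sq (\<rho> (V \<omega>) + matrix_inv (covariance_matrix M V) *v V \<omega>) \<partial>M)"

definition J_st :: "'a measure \<Rightarrow> ('a \<Rightarrow> real^'n) \<Rightarrow> (real^'n \<Rightarrow> real^'n) \<Rightarrow> real" where
  "J_st M V \<rho> = trace (covariance_matrix M V ** fisher_info_matrix M V \<rho>)"

definition interp :: "('a \<Rightarrow> real^'n) \<Rightarrow> ('a \<Rightarrow> real^'n) \<Rightarrow> real \<Rightarrow> 'a \<Rightarrow> real^'n" where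
  "interp X Z t \<omega> = sqrt t *\<^sub>R X \<omega> + sqrt (1 - t) *\<^sub>R Z \<omega>"

definition MMSE :: "'a measure \<Rightarrow> ('a \<Rightarrow> real^'n) \<Rightarrow> ('a \<Rightarrow> real^'n) \<Rightarrow> real \<Rightarrow> real^'n^'n" where
  "MMSE M X Z t = (\<integral>\<omega>. vec_sq (X \<omega> - vec_cond_exp M (interp X Z t) X \<omega>) \<partial>M)"

end

(* Write V for interp X Z t, P for the inverse of C and Y = E[X | V] - sqrt t V.
   Gaussian integration by parts in Z shows that the score of V satisfies
   rho(V) + P V = (sqrt t / (1 - t)) P Y.  Integrating by parts in Z and then using the Stein
   identity in X shows that E[(1 - P tau(X)) P Z | V] = - P Y / sqrt (t (1 - t)): both sides have
   the same integral against every smooth compactly supported function of V, and such functions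
   determine a function of V up to null sets.  Both claims then follow from
   E[Y Y^T] = (1 - t) C - MMSE, a second moment computation. *)
theory Submission
  imports Defs
begin

section \<open>Smooth functions with compact support\<close>

text \<open>The Stein identity speaks of test functions of X, and \<phi>(V) is one only while Z is
  frozen. Freezing needs Fubini, and Fubini needs every entry of \<tau>(X) to be integrable. Beyond
  the Stein identity itself, integrability is granted only for the vector (Id - P \<tau>(X)) P Z,
  where it gives E[ . | V] its meaning. The gap closes because the law of Z gives measure zero to
  every proper subspace: integrability of \<tau>(X) P z for almost every z spreads to every z.

  A score is integrable only after multiplication by a test function. Uniqueness is therefore proved
  for locally integrable functions and an arbitrary law of V, and \<open>J_st\<close> is computed
  from one explicit score and carried over to every other one.

  No Gaussian integral is evaluated. Positivity of det C comes from the total mass of the density,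
  tail bounds come from rescaling it, and the moments of Z come from integration by parts, which for
  this purpose admits functions of linear growth.\<close>

lemma grad_eqI:
  fixes f :: "real^'n \<Rightarrow> real"
  assumes "(f has_derivative f') (at x)"
  shows "grad f x $ i = f' (axis i 1)"
  using frechet_derivative_at[OF assms] by (simp add: grad_def)

lemma has_derivative_grad:
  assumes "f differentiable (at x)"
  shows "(f has_derivative (\<lambda>h. grad f x \<bullet> h)) (at x)"
proof -
  let ?D = "frechet_derivative f (at x)"
  have D: "(f has_derivative ?D) (at x)"
    using assms frechet_derivative_works by blast
  interpret linear ?D
    using D has_derivative_linear by blast
  have "?D h = grad f x \<bullet> h" for h
  proof -
    have "?D h = ?D (\<Sum>i\<in>UNIV. (h $ i) *\<^sub>R axis i 1)"
      using basis_expansion[of h] by (simp add: scalar_mult_eq_scaleR)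
    also have "\<dots> = (\<Sum>i\<in>UNIV. (h $ i) * ?D (axis i 1))"
      by (simp add: sum scaleR)
    also have "\<dots> = grad f x \<bullet> h"
      by (simp add: inner_vec_def grad_def mult.commute)
    finally show ?thesis .
  qed
  then show ?thesis
    using D ext[of ?D "\<lambda>h. grad f x \<bullet> h"] by simp
qed

lemma grad_const: "grad (\<lambda>x. c) = (\<lambda>x. 0)"
  by (simp add: fun_eq_iff vec_eq_iff grad_def)

lemma times_differentiable_const: "times_differentiable k (\<lambda>x. c)"
  by (induction k arbitrary: c) (auto simp: grad_const)

lemma times_differentiable_SucD:
  "times_differentiable (Suc k) f \<Longrightarrow> times_differentiable k f"
  by (induction k arbitrary: f) auto

lemma times_differentiable_add:
  "times_differentiable k f \<Longrightarrow> times_differentiable k g \<Longrightarrow> times_differentiable k (\<lambda>x. f x + g x)"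
proof (induction k arbitrary: f g)
  case (Suc k)
  have "grad (\<lambda>x. f x + g x) x $ i = grad f x $ i + grad g x $ i" for x i
    using Suc.prems by (subst grad_eqI[OF has_derivative_add[OF has_derivative_grad has_derivative_grad]])
      (auto simp: inner_axis)
  then show ?case
    using Suc by (auto simp: differentiable_add)
qed auto

lemma times_differentiable_mult:
  "times_differentiable k f \<Longrightarrow> times_differentiable k g \<Longrightarrow> times_differentiable k (\<lambda>x. f x * g x)"
proof (induction k arbitrary: f g)
  case (Suc k)
  have "grad (\<lambda>x. f x * g x) x $ i = f x * grad g x $ i + grad f x $ i * g x" for x i
    using Suc.prems by (subst grad_eqI[OF has_derivative_mult[OF has_derivative_grad has_derivative_grad]])
      (auto simp: inner_axis)
  moreover have "times_differentiable k f" "times_differentiable k g"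
    using Suc.prems times_differentiable_SucD by blast+
  ultimately show ?case
    using Suc by (auto simp: differentiable_mult times_differentiable_add)
qed auto

lemma times_differentiable_cmult:
  "times_differentiable k f \<Longrightarrow> times_differentiable k (\<lambda>x. c * f x)"
  using times_differentiable_mult[OF times_differentiable_const] .

lemma times_differentiable_power:
  "times_differentiable k f \<Longrightarrow> times_differentiable k (\<lambda>x. f x ^ n)"
  by (induction n) (auto simp: times_differentiable_const times_differentiable_mult)

lemma grad_affine:
  fixes f :: "real^'n \<Rightarrow> real"
  assumes "f differentiable (at (a *\<^sub>R x + b))"
  shows "grad (\<lambda>x. f (a *\<^sub>R x + b)) x = a *\<^sub>R grad f (a *\<^sub>R x + b)"
proof -
  have "((\<lambda>x. a *\<^sub>R x + b) has_derivative (\<lambda>h. a *\<^sub>R h)) (at x)"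
    by (auto intro!: derivative_eq_intros)
  from diff_chain_at[OF this has_derivative_grad[OF assms]]
  have "((\<lambda>x. f (a *\<^sub>R x + b)) has_derivative (\<lambda>h. grad f (a *\<^sub>R x + b) \<bullet> (a *\<^sub>R h))) (at x)"
    by (simp add: o_def)
  then show ?thesis
    by (simp add: vec_eq_iff grad_eqI inner_axis)
qed

lemma differentiable_affine:
  fixes f :: "real^'n \<Rightarrow> real"
  assumes "\<And>x. f differentiable (at x)"
  shows "(\<lambda>x. f (a *\<^sub>R x + b)) differentiable (at x)"
proof -
  have "(\<lambda>x. a *\<^sub>R x + b) differentiable (at x)"
    by (intro derivative_intros)
  from differentiable_chain_at[OF this assms] show ?thesis
    by (simp add: o_def)
qed

lemma times_differentiable_affine:
  "times_differentiable k f \<Longrightarrow> times_differentiable k (\<lambda>x. f (a *\<^sub>R x + b))"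
proof (induction k arbitrary: f)
  case (Suc k)
  have "grad (\<lambda>x. f (a *\<^sub>R x + b)) x = a *\<^sub>R grad f (a *\<^sub>R x + b)" for x
    using Suc.prems by (simp add: grad_affine)
  moreover have "times_differentiable k (\<lambda>x. a * grad f (a *\<^sub>R x + b) $ i)" for i
    using Suc.prems by (intro times_differentiable_cmult Suc.IH) simp
  ultimately show ?case
    using Suc.prems differentiable_affine[of f a b] by simp
qed auto

lemma times_differentiable_component: "times_differentiable k (\<lambda>x::real^'n. x $ j)"
proof (cases k)
  case (Suc k')
  have D: "((\<lambda>x. x $ j) has_derivative (\<lambda>h. h $ j)) (at x)" for x :: "real^'n"
    using bounded_linear_vec_nth by (rule bounded_linear_imp_has_derivative)
  moreover have "(\<lambda>x. grad (\<lambda>x::real^'n. x $ j) x $ i) = (\<lambda>x. axis i 1 $ j)" for i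
    by (simp add: grad_eqI[OF D])
  ultimately show ?thesis
    by (auto simp: Suc differentiable_def times_differentiable_const)
qed simp

lemma times_differentiable_sum:
  "finite I \<Longrightarrow> (\<And>i. i \<in> I \<Longrightarrow> times_differentiable k (f i)) \<Longrightarrow> times_differentiable k (\<lambda>x. \<Sum>i\<in>I. f i x)"
  by (induction I rule: finite_induct) (auto simp: times_differentiable_const times_differentiable_add)

text \<open>The span of this family is closed under differentiation, which makes smoothness at
  \<open>0\<close> an induction.\<close>

definition flat_exp :: "nat \<Rightarrow> real \<Rightarrow> real" where
  "flat_exp k x = (if x > 0 then (1 / x) ^ k * exp (- (1 / x)) else 0)"

text \<open>From the right, y = 1/x turns the claim into y^k exp(-y) tending to 0 at infinity; from
  the left the function is identically 0.\<close>

lemma flat_exp_tendsto_0: "(flat_exp k \<longlongrightarrow> 0) (at 0)"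
proof -
  have "((\<lambda>x. (1 / x) ^ k * exp (- (1 / x))) \<longlongrightarrow> 0) (at_right (0::real))"
  proof -
    have "filterlim (\<lambda>x::real. 1 / x) at_top (at_right 0)"
      using filterlim_inverse_at_top_right by (simp add: inverse_eq_divide)
    from filterlim_compose[OF tendsto_power_div_exp_0[of k] this] show ?thesis
      by (simp add: exp_minus field_simps)
  qed
  moreover have "\<forall>\<^sub>F x in at_right 0. flat_exp k x = (1 / x) ^ k * exp (- (1 / x))"
    by (auto simp: eventually_at_right_field flat_exp_def intro!: exI[of _ 1])
  ultimately have "(flat_exp k \<longlongrightarrow> 0) (at_right 0)"
    by (simp add: tendsto_cong)
  moreover have "\<forall>\<^sub>F x in at_left 0. flat_exp k x = 0"
    by (auto simp: eventually_at_left_field flat_exp_def intro!: exI[of _ "-1"])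
  then have "(flat_exp k \<longlongrightarrow> 0) (at_left 0)"
    by (simp add: tendsto_eventually)
  ultimately show ?thesis
    by (simp add: filterlim_split_at)
qed

text \<open>For x > 0, differentiating the exponential raises the exponent by two and
  differentiating the power raises it by one. At 0 the difference quotient is itself a member of the
  family, so its limit is the one already known.\<close>

lemma DERIV_flat_exp:
  "(flat_exp k has_real_derivative (flat_exp (k + 2) x - real k * flat_exp (k + 1) x)) (at x)"
proof -
  consider "x > 0" | "x < 0" | "x = 0" by linarith
  then show ?thesis
  proof cases
    case 1
    let ?f = "\<lambda>x::real. (1 / x) ^ k * exp (- (1 / x))"
    have "(?f has_real_derivative (flat_exp (k + 2) x - real k * flat_exp (k + 1) x)) (at x)"
    proof -
      have "((\<lambda>x::real. 1 / x) has_real_derivative - ((1 / x) * (1 / x))) (at x)"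
        using 1 by (auto intro!: derivative_eq_intros)
      note D = this DERIV_power[OF this, of k] DERIV_fun_exp[OF DERIV_minus[OF this]]
      \<comment> \<open>The power rule leaves the exponent \<open>k - Suc 0\<close>. At
        \<open>k = 0\<close> the truncated subtraction is harmless, because the factor
        \<open>real k\<close> vanishes.\<close>
      have "real k * (- (y * y) * y ^ (k - Suc 0)) * e + e * (- (- (y * y))) * y ^ k =
          y ^ (k + 2) * e - real k * (y ^ (k + 1) * e)" for y e :: real
        by (cases k) (simp_all add: algebra_simps)
      note eq = this[of "1 / x" "exp (- (1 / x))"]
      show ?thesis
        unfolding flat_exp_def if_P[OF 1] using DERIV_mult[OF D(2,3)] by (simp only: eq)
    qed
    moreover have "\<forall>\<^sub>F y in nhds x. flat_exp k y = ?f y"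
      using eventually_nhds_in_open[of "{0<..}" x] 1
      by (auto simp: flat_exp_def elim!: eventually_mono)
    ultimately show ?thesis
      by (simp add: DERIV_cong_ev)
  next
    case 2
    have "\<forall>\<^sub>F y in nhds x. flat_exp k y = 0"
      using eventually_nhds_in_open[of "{..<0}" x] 2
      by (auto simp: flat_exp_def elim!: eventually_mono)
    then have "(flat_exp k has_real_derivative 0) (at x)"
      by (simp add: DERIV_cong_ev)
    then show ?thesis
      using 2 by (simp add: flat_exp_def)
  next
    case 3
    \<comment> \<open>This is an equality of functions, \<open>h = 0\<close> included: there the
      quotient is 0 by the convention for division by zero.\<close>
    have "(\<lambda>h. (flat_exp k (0 + h) - flat_exp k 0) / h) = flat_exp (Suc k)"
      by (auto simp: flat_exp_def fun_eq_iff)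
    then have "(flat_exp k has_real_derivative 0) (at 0)"
      unfolding has_field_derivative_def
      using flat_exp_tendsto_0[of "Suc k"] by (simp add: DERIV_def flip: has_field_derivative_def)
    then show ?thesis
      using 3 by (simp add: flat_exp_def)
  qed
qed

text \<open>The index \<open>k\<close> has to vary in the induction on the order, since the chain
  rule calls for smoothness of the compositions with index \<open>k + 1\<close> and
  \<open>k + 2\<close>.\<close>

lemma times_differentiable_flat_exp_comp:
  assumes p: "\<And>k. times_differentiable k p"
  shows "times_differentiable n (\<lambda>x. flat_exp k (p x))"
proof (induction n arbitrary: k)
  case (Suc n)
  let ?d = "\<lambda>x. flat_exp (k + 2) (p x) + (- real k) * flat_exp (k + 1) (p x)"
  have D: "((\<lambda>x. flat_exp k (p x)) has_derivative (\<lambda>h. ?d x * (grad p x \<bullet> h))) (at x)" for x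
  proof -
    have "p differentiable (at x)"
      using p[of "Suc 0"] by simp
    from diff_chain_at[OF has_derivative_grad[OF this]
        DERIV_flat_exp[of k "p x", unfolded has_field_derivative_def]]
    show ?thesis by (simp add: o_def algebra_simps)
  qed
  have "grad (\<lambda>x. flat_exp k (p x)) x $ i = ?d x * grad p x $ i" for x i
    by (subst grad_eqI[OF D]) (simp add: inner_axis)
  moreover have "times_differentiable n ?d"
    by (intro times_differentiable_add times_differentiable_cmult Suc.IH)
  moreover have "times_differentiable n (\<lambda>x. grad p x $ i)" for i
    using p[of "Suc n"] by simp
  moreover have "(\<lambda>x. flat_exp k (p x)) differentiable (at x)" for x
    using D differentiable_def by blast
  ultimately show ?case
    by (simp add: times_differentiable_mult)
qed simp

section \<open>Bounds and closure properties of test functions\<close>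

lemma Cc_infinity_differentiable: "\<phi> \<in> Cc_infinity \<Longrightarrow> \<phi> differentiable (at x)"
  unfolding Cc_infinity_def by (metis (no_types, lifting) mem_Collect_eq times_differentiable.simps(2))

lemma Cc_infinity_continuous: "\<phi> \<in> Cc_infinity \<Longrightarrow> continuous_on UNIV \<phi>"
  by (intro continuous_at_imp_continuous_on ballI differentiable_imp_continuous_within
      Cc_infinity_differentiable)

lemma Cc_infinity_grad_differentiable:
  assumes "\<phi> \<in> Cc_infinity"
  shows "(\<lambda>x. grad \<phi> x $ i) differentiable (at x)"
proof -
  have "times_differentiable (Suc (Suc 0)) \<phi>"
    using assms by (simp only: Cc_infinity_def mem_Collect_eq)
  then show ?thesis by simp
qed

lemma Cc_infinity_grad_continuous:
  "\<phi> \<in> Cc_infinity \<Longrightarrow> continuous_on UNIV (grad \<phi>)"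
proof -
  assume "\<phi> \<in> Cc_infinity"
  then have "continuous_on UNIV (\<lambda>x. \<chi> i. grad \<phi> x $ i)"
    by (intro continuous_on_vec_lambda continuous_at_imp_continuous_on ballI
        differentiable_imp_continuous_within Cc_infinity_grad_differentiable)
  then show ?thesis by simp
qed

text \<open>Both maps are continuous, hence bounded on the compact closure of the support. Off that
  closed set \<phi> vanishes near every point, so its gradient vanishes too. One constant for both
  spares a case distinction wherever \<phi> or its gradient multiplies an integrable
  function.\<close>

lemma Cc_infinity_bounded:
  assumes "\<phi> \<in> Cc_infinity"
  obtains B where "B > 0" "\<And>x. \<bar>\<phi> x\<bar> \<le> B" "\<And>x. norm (grad \<phi> x) \<le> B"
proof -
  let ?K = "closure {x. \<phi> x \<noteq> 0}"
  have K: "compact ?K" using assms by (simp add: Cc_infinity_def)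
  have bd: "bounded (\<phi> ` ?K)" "bounded (grad \<phi> ` ?K)"
    by (rule compact_imp_bounded[OF compact_continuous_image[OF continuous_on_subset[OF _ subset_UNIV] K]],
        rule Cc_infinity_continuous[OF assms] Cc_infinity_grad_continuous[OF assms])+
  obtain B1 where B1: "B1 > 0" "\<forall>y\<in>\<phi> ` ?K. norm y \<le> B1"
    using bd(1) unfolding bounded_pos by blast
  obtain B2 where B2: "B2 > 0" "\<forall>y\<in>grad \<phi> ` ?K. norm y \<le> B2"
    using bd(2) unfolding bounded_pos by blast
  have "grad \<phi> x = 0" if "x \<notin> ?K" for x
  proof -
    have "(\<phi> has_derivative (\<lambda>h. 0)) (at x)"
      using that closure_subset[of "{x. \<phi> x \<noteq> 0}"]
      by - (rule has_derivative_transform_within_open[of "\<lambda>x. 0" _ x UNIV "- ?K"], auto)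
    then show ?thesis by (simp add: vec_eq_iff grad_eqI)
  qed
  note grad0 = this
  have \<phi>0: "\<phi> x = 0" if "x \<notin> ?K" for x
    using that closure_subset[of "{x. \<phi> x \<noteq> 0}"] by auto
  have 1: "\<bar>\<phi> x\<bar> \<le> B1 + B2" for x
  proof (cases "x \<in> ?K")
    case True
    have "norm (\<phi> x) \<le> B1" by (rule bspec[OF B1(2) imageI[OF True]])
    then show ?thesis using B2(1) by simp
  next
    case False
    from \<phi>0[OF this] show ?thesis using B1(1) B2(1) by simp
  qed
  have 2: "norm (grad \<phi> x) \<le> B1 + B2" for x
  proof (cases "x \<in> ?K")
    case True
    have "norm (grad \<phi> x) \<le> B2" by (rule bspec[OF B2(2) imageI[OF True]])
    then show ?thesis using B1(1) by simp
  next
    case False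
    from grad0[OF this] show ?thesis using B1(1) B2(1) by simp
  qed
  show ?thesis
    using that[OF _ 1 2] B1(1) B2(1) by simp
qed

lemma Cc_infinity_mult:
  assumes "\<phi> \<in> Cc_infinity" "\<And>k. times_differentiable k \<psi>"
  shows "(\<lambda>x. \<phi> x * \<psi> x) \<in> Cc_infinity"
proof -
  have "bounded {x. \<phi> x \<noteq> 0}"
    using assms(1) by (simp add: Cc_infinity_def)
  then have "bounded {x. \<phi> x * \<psi> x \<noteq> 0}"
    by (rule bounded_subset) auto
  then show ?thesis
    using assms by (simp add: Cc_infinity_def times_differentiable_mult)
qed

text \<open>Its role is to freeze z in \<phi>(sqrt t x + sqrt (1 - t) z), which must remain a test
  function of x. With \<open>a = 0\<close> the function would be constant and its support possibly
  the whole space.\<close>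

lemma Cc_infinity_affine:
  fixes \<phi> :: "real^'n \<Rightarrow> real"
  assumes \<phi>: "\<phi> \<in> Cc_infinity" and a: "a \<noteq> 0"
  shows "(\<lambda>x. \<phi> (a *\<^sub>R x + b)) \<in> Cc_infinity"
proof -
  have "{x. \<phi> (a *\<^sub>R x + b) \<noteq> 0} \<subseteq> (\<lambda>y. (1 / a) *\<^sub>R y + (- (1 / a) *\<^sub>R b)) ` {x. \<phi> x \<noteq> 0}"
  proof
    fix x assume "x \<in> {x. \<phi> (a *\<^sub>R x + b) \<noteq> 0}"
    then show "x \<in> (\<lambda>y. (1 / a) *\<^sub>R y + (- (1 / a) *\<^sub>R b)) ` {x. \<phi> x \<noteq> 0}"
      using a by (intro image_eqI[of _ _ "a *\<^sub>R x + b"]) (auto simp: algebra_simps)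
  qed
  moreover have "bounded ((\<lambda>y. (1 / a) *\<^sub>R y + (- (1 / a) *\<^sub>R b)) ` {x. \<phi> x \<noteq> 0})"
  proof -
    have "bounded ((\<lambda>y. (1 / a) *\<^sub>R y) ` {x. \<phi> x \<noteq> 0})"
      using \<phi> by (intro bounded_scaling) (simp add: Cc_infinity_def)
    from bounded_translation[OF this, of "- (1 / a) *\<^sub>R b"] show ?thesis
      by (simp add: image_image add.commute)
  qed
  ultimately have "bounded {x. \<phi> (a *\<^sub>R x + b) \<noteq> 0}"
    by (rule bounded_subset[rotated])
  then show ?thesis
    using \<phi> by (simp add: Cc_infinity_def times_differentiable_affine)
qed

text \<open>The classical bump exp(-1 / (r^2 - |x - c|^2)), extended by 0. Squaring the norm makes
  the inner function a polynomial, hence smooth at the centre as well.\<close>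

definition ball_bump :: "real^'n \<Rightarrow> real \<Rightarrow> real^'n \<Rightarrow> real" where
  "ball_bump c r x = flat_exp 0 (r\<^sup>2 - (norm (x - c))\<^sup>2)"

lemma ball_bump_nonneg: "0 \<le> ball_bump c r x"
  by (simp add: ball_bump_def flat_exp_def)

lemma ball_bump_eq_0_iff: "r > 0 \<Longrightarrow> ball_bump c r x = 0 \<longleftrightarrow> x \<notin> ball c r"
proof -
  assume "r > 0"
  then have "(norm (x - c))\<^sup>2 < r\<^sup>2 \<longleftrightarrow> norm (x - c) < r"
    using abs_le_square_iff[of r "norm (x - c)"] by (metis abs_norm_cancel abs_of_pos linorder_not_le)
  then show ?thesis
    by (simp add: ball_bump_def flat_exp_def dist_norm norm_minus_commute)
qed

lemma ball_bump_Cc_infinity: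
  assumes "r > 0"
  shows "ball_bump c r \<in> Cc_infinity"
proof -
  have "times_differentiable k (\<lambda>x. (x - c) $ i)" for k i
    using times_differentiable_affine[OF times_differentiable_component, of k 1 "- c" i] by simp
  then have "times_differentiable k (\<lambda>x. (x - c) $ i * (x - c) $ i)" for k i
    using times_differentiable_mult by blast
  then have "times_differentiable k (\<lambda>x. \<Sum>i\<in>UNIV. (x - c) $ i * (x - c) $ i)" for k
    by (rule times_differentiable_sum[OF finite])
  then have "times_differentiable k (\<lambda>x. r\<^sup>2 + (- 1) * (\<Sum>i\<in>UNIV. (x - c) $ i * (x - c) $ i))" for k
    by (rule times_differentiable_add[OF times_differentiable_const times_differentiable_cmult])
  then have p: "times_differentiable k (\<lambda>x. r\<^sup>2 - (norm (x - c))\<^sup>2)" for k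
    unfolding power2_norm_eq_inner inner_vec_def by simp
  have "times_differentiable k (ball_bump c r)" for k
    using times_differentiable_flat_exp_comp[of "\<lambda>x. r\<^sup>2 - (norm (x - c))\<^sup>2" k 0, OF p]
    by (simp only: ball_bump_def[abs_def])
  moreover have "{x. ball_bump c r x \<noteq> 0} = ball c r"
    using ball_bump_eq_0_iff[of r c] assms by blast
  ultimately show ?thesis
    unfolding Cc_infinity_def by (simp del: ball_eq_empty)
qed

section \<open>Test functions determine a function almost everywhere\<close>

lemma Cc_infinity_bounded_support: "\<phi> \<in> Cc_infinity \<Longrightarrow> bounded {x. \<phi> x \<noteq> 0}"
  by (simp add: Cc_infinity_def)

lemma Cc_infinity_borel: "\<phi> \<in> Cc_infinity \<Longrightarrow> \<phi> \<in> borel_measurable borel"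
  by (intro borel_measurable_continuous_onI Cc_infinity_continuous)

lemma Cc_infinity_times_differentiable: "\<phi> \<in> Cc_infinity \<Longrightarrow> times_differentiable k \<phi>"
  unfolding Cc_infinity_def by blast

lemma Cc_infinity_open_support: "\<phi> \<in> Cc_infinity \<Longrightarrow> open {x. \<phi> x \<noteq> 0}"
  by (intro open_Collect_neq Cc_infinity_continuous continuous_on_const)

text \<open>Every open set is a union of balls, by Lindelof a countable one, and each ball is the
  nonzero set of a bump. This generator is closed under intersection, because test functions can be
  multiplied, which suits an induction over disjoint unions and complements.\<close>

lemma borel_eq_Cc_infinity_supports:
  "sets (borel :: (real^'n) measure) = sigma_sets UNIV {{x. \<phi> x \<noteq> 0} |\<phi>. \<phi> \<in> Cc_infinity}"
    (is "_ = sigma_sets UNIV ?G")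
proof -
  have "U \<in> sigma_sets UNIV ?G" if U: "open U" for U :: "(real^'n) set"
  proof -
    let ?F = "{ball x r |x r. 0 < r \<and> ball x r \<subseteq> U}"
    have "\<Union> ?F = U"
    proof (rule subset_antisym)
      show "U \<subseteq> \<Union> ?F"
      proof
        fix x assume "x \<in> U"
        then obtain r where "0 < r" "ball x r \<subseteq> U"
          by (rule openE[OF U])
        then show "x \<in> \<Union> ?F"
          using centre_in_ball[of x r] by blast
      qed
    qed blast
    moreover obtain F' where F': "F' \<subseteq> ?F" "countable F'" "\<Union> F' = \<Union> ?F"
      by (rule Lindelof[of ?F]) (use open_ball in blast)
    moreover have "S \<in> sigma_sets UNIV ?G" if S: "S \<in> F'" for S
    proof -
      obtain x r where xr: "S = ball x r" "0 < r"
        using F'(1) S by blast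
      then have "S = {y. ball_bump x r y \<noteq> 0}"
        using ball_bump_eq_0_iff by blast
      then show ?thesis
        using ball_bump_Cc_infinity[OF xr(2)] by (intro sigma_sets.Basic) blast
    qed
    ultimately have "\<Union> F' \<in> sigma_sets UNIV ?G"
      by (intro sigma_sets_UNION) auto
    then show ?thesis
      using F'(3) \<open>\<Union> ?F = U\<close> by argo
  qed
  then have "sigma_sets UNIV {U :: (real^'n) set. open U} \<subseteq> sigma_sets UNIV ?G"
    by (intro sigma_sets_mono) auto
  moreover have "{x. \<phi> x \<noteq> 0} \<in> sets borel" if "\<phi> \<in> Cc_infinity" for \<phi> :: "real^'n \<Rightarrow> real"
    by (rule borel_open[OF Cc_infinity_open_support[OF that]])
  then have "sigma_sets UNIV ?G \<subseteq> sets (borel :: (real^'n) measure)"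
    by (intro sets.sigma_sets_subset[of _ borel, simplified]) auto
  ultimately show ?thesis
    by (simp add: borel_def)
qed

text \<open>Only products of \<open>u\<close> with test functions are integrable, so the argument is
  carried out on balls. The integral of \<open>u\<close> over the nonzero set of a test function
  vanishes by approximating its indicator from within the test functions. It then vanishes over all
  Borel subsets of a ball by induction over the generator, which forces \<open>u\<close> to be 0
  almost everywhere there.\<close>

lemma Cc_infinity_AE_zero:
  fixes u :: "real^'n \<Rightarrow> real"
  assumes sets: "sets \<mu> = sets borel"
    and u: "u \<in> borel_measurable borel"
    and int: "\<And>\<phi>. \<phi> \<in> Cc_infinity \<Longrightarrow> integrable \<mu> (\<lambda>x. \<phi> x * u x)"
    and zero: "\<And>\<phi>. \<phi> \<in> Cc_infinity \<Longrightarrow> (\<integral>x. \<phi> x * u x \<partial>\<mu>) = 0"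
  shows "AE x in \<mu>. u x = 0"
proof -
  have meas: "h \<in> borel_measurable \<mu>" if "h \<in> borel_measurable borel" for h :: "real^'n \<Rightarrow> real"
    using that measurable_cong_sets[OF sets refl] by blast
  note [measurable] = u
  have [measurable]: "ball c r \<in> sets borel" for c :: "real^'n" and r by simp
  have space: "space \<mu> = UNIV"
    using sets_eq_imp_space_eq[OF sets] by simp
  have int_ball: "integrable \<mu> (\<lambda>x. indicator (ball 0 r) x * u x)" if r: "r > 0" for r
  proof -
    let ?\<Phi> = "ball_bump 0 (2 * r) :: real^'n \<Rightarrow> real"
    \<comment> \<open>On \<open>ball 0 r\<close> the argument
      \<open>(2 * r)\<^sup>2 - (norm x)\<^sup>2\<close> of the larger bump is at least
      \<open>3 * r\<^sup>2\<close>, so \<open>k\<close> bounds that bump from below there.\<close>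
    define k where "k = exp (- (1 / (3 * r\<^sup>2)))"
    have k: "k > 0" by (simp add: k_def)
    have "integrable \<mu> (\<lambda>x. (1 / k) * (?\<Phi> x * u x))"
      using r by (intro integrable_mult_right int ball_bump_Cc_infinity) simp
    then show ?thesis
    proof (rule Bochner_Integration.integrable_bound)
      show "AE x in \<mu>. norm (indicator (ball 0 r) x * u x) \<le> norm ((1 / k) * (?\<Phi> x * u x))"
      proof (rule AE_I2)
        fix x
        show "norm (indicator (ball 0 r) x * u x) \<le> norm ((1 / k) * (?\<Phi> x * u x))"
        proof (cases "x \<in> ball 0 r")
          case True
          then have "(norm x)\<^sup>2 < r\<^sup>2"
            by (intro power_strict_mono) auto
          moreover define y where "y = (2 * r)\<^sup>2 - (norm x)\<^sup>2"
          ultimately have *: "3 * r\<^sup>2 \<le> y"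
            by (simp add: power2_eq_square)
          have "0 < 3 * r\<^sup>2" using r by simp
          with * have "0 < y" by (rule less_le_trans[rotated])
          with * \<open>0 < 3 * r\<^sup>2\<close> have "1 / y \<le> 1 / (3 * r\<^sup>2)"
            by (intro divide_left_mono mult_pos_pos) auto
          moreover have "?\<Phi> x = flat_exp 0 y"
            by (simp add: ball_bump_def y_def)
          ultimately have "k \<le> ?\<Phi> x"
            using \<open>0 < y\<close> by (simp add: flat_exp_def k_def)
          then have "1 * \<bar>u x\<bar> \<le> (?\<Phi> x / k) * \<bar>u x\<bar>"
            using k by (intro mult_right_mono) auto
          then show ?thesis
            using True k ball_bump_nonneg[of 0 "2 * r" x] by (simp add: abs_mult)
        qed simp
      qed
    qed (rule meas, measurable)
  qed
  have supp: "(\<integral>x. indicator {x. \<phi> x \<noteq> 0} x * u x \<partial>\<mu>) = 0" if \<phi>: "\<phi> \<in> Cc_infinity" for \<phi>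
  proof -
    obtain B where B: "B > 0" "\<And>x. \<bar>\<phi> x\<bar> \<le> B"
      by (rule Cc_infinity_bounded[OF \<phi>]) (rule that)
    \<comment> \<open>The normalised square takes values between 0 and 1, has the same zeros as
      \<phi>, and is still a test function.\<close>
    define \<psi> where "\<psi> x = \<phi> x * (1 / B\<^sup>2 * \<phi> x)" for x
    have \<psi>_Cc: "\<psi> \<in> Cc_infinity"
      unfolding \<psi>_def[abs_def]
      by (rule Cc_infinity_mult[OF \<phi> times_differentiable_cmult[OF Cc_infinity_times_differentiable[OF \<phi>]]])
    have \<psi>0: "0 \<le> \<psi> x" "\<psi> x \<le> 1" and \<psi>_supp: "\<psi> x = 0 \<longleftrightarrow> \<phi> x = 0" for x
    proof -
      have "(\<phi> x)\<^sup>2 \<le> B\<^sup>2"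
        using B(1) B(2)[of x] by (metis abs_le_square_iff abs_of_pos)
      then show "0 \<le> \<psi> x" "\<psi> x \<le> 1" "\<psi> x = 0 \<longleftrightarrow> \<phi> x = 0"
        using B(1) by (auto simp: \<psi>_def power2_eq_square divide_le_eq)
    qed
    \<comment> \<open>\<open>g n = 1 - (1 - \<psi>) ^ n\<close>, which tends to the indicator of the support of \<open>\<phi>\<close>\<close>
    define g where "g n x = \<psi> x * (\<Sum>i<n. (1 + (- 1) * \<psi> x) ^ i)" for n x
    \<comment> \<open>In the geometric sum form \<psi> is an explicit factor, which makes the
      compact support visible.\<close>
    have g_Cc: "g n \<in> Cc_infinity" for n
      unfolding g_def[abs_def]
      by (intro Cc_infinity_mult[OF \<psi>_Cc] times_differentiable_sum times_differentiable_power
          times_differentiable_add[OF times_differentiable_const times_differentiable_cmult]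
          Cc_infinity_times_differentiable[OF \<psi>_Cc]) simp
    have g_eq: "g n x = 1 - (1 - \<psi> x) ^ n" for n x
      using one_diff_power_eq[of "1 - \<psi> x" n] by (simp add: g_def)
    obtain R where R: "R > 0" "{x. \<phi> x \<noteq> 0} \<subseteq> ball 0 R"
      using bounded_subset_ballD[OF Cc_infinity_bounded_support[OF \<phi>], of 0] by auto

    have "(\<lambda>n. \<integral>x. g n x * u x \<partial>\<mu>) \<longlonglongrightarrow> (\<integral>x. indicator {x. \<phi> x \<noteq> 0} x * u x \<partial>\<mu>)"
    proof (rule integral_dominated_convergence)
      show "integrable \<mu> (\<lambda>x. \<bar>indicator (ball 0 R) x * u x\<bar>)"
        using int_ball[OF R(1)] by (rule integrable_abs)
      show "AE x in \<mu>. (\<lambda>n. g n x * u x) \<longlonglongrightarrow> indicator {x. \<phi> x \<noteq> 0} x * u x"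
      proof (rule AE_I2)
        fix x
        have "(\<lambda>n. g n x) \<longlonglongrightarrow> indicator {x. \<phi> x \<noteq> 0} x"
        proof (cases "\<phi> x = 0")
          case True
          then have "\<psi> x = 0" using \<psi>_supp[of x] by blast
          with True show ?thesis by (simp add: g_def)
        next
          case False
          then have "\<psi> x > 0" using \<psi>0(1)[of x] \<psi>_supp[of x] by linarith
          then have "(\<lambda>n. (1 - \<psi> x) ^ n) \<longlonglongrightarrow> 0"
            using \<psi>0(2)[of x] by (intro LIMSEQ_power_zero) auto
          from tendsto_diff[OF tendsto_const this, of 1] show ?thesis
            using False by (simp add: g_eq)
        qed
        then show "(\<lambda>n. g n x * u x) \<longlonglongrightarrow> indicator {x. \<phi> x \<noteq> 0} x * u x"
          by (intro tendsto_mult tendsto_const)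
      qed
      show "AE x in \<mu>. norm (g n x * u x) \<le> \<bar>indicator (ball 0 R) x * u x\<bar>" for n
      proof (rule AE_I2)
        fix x
        show "norm (g n x * u x) \<le> \<bar>indicator (ball 0 R) x * u x\<bar>"
        proof (cases "\<phi> x = 0")
          case True
          then have "\<psi> x = 0" using \<psi>_supp[of x] by blast
          with True show ?thesis by (simp add: g_def)
        next
          case False
          then have "x \<in> ball 0 R" using R(2) by blast
          moreover have "0 \<le> (1 - \<psi> x) ^ n" "(1 - \<psi> x) ^ n \<le> 1"
            using \<psi>0[of x] by (auto intro: power_le_one)
          then have "\<bar>g n x\<bar> \<le> 1" by (simp add: g_eq)
          then have "\<bar>g n x\<bar> * \<bar>u x\<bar> \<le> 1 * \<bar>u x\<bar>" by (rule mult_right_mono) simp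
          ultimately show ?thesis by (simp add: abs_mult)
        qed
      qed
    qed (intro meas borel_measurable_times borel_measurable_indicator u Cc_infinity_borel[OF g_Cc]
        borel_open Cc_infinity_open_support[OF \<phi>])+
    then show ?thesis
      using zero[OF g_Cc] LIMSEQ_unique[OF tendsto_const] by fastforce
  qed
  have AE_ball: "AE x in \<mu>. indicator (ball 0 r) x * u x = 0" if r: "r > 0" for r
  proof (rule density_unique_real)
    let ?f = "\<lambda>x. indicator (ball 0 r) x * u x"
    let ?G = "{{x. \<phi> x \<noteq> 0} |\<phi>. \<phi> \<in> Cc_infinity} :: (real^'n) set set"
    show f: "integrable \<mu> ?f" by (rule int_ball[OF r])
    have f_on: "set_integrable \<mu> A ?f" if "A \<in> sets \<mu>" for A
      using integrable_mult_indicator[OF that f] by (simp add: set_integrable_def)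
    fix A assume "A \<in> sets \<mu>"
    then have A: "A \<in> sigma_sets UNIV ?G"
      unfolding sets borel_eq_Cc_infinity_supports .
    have Int_stable: "Int_stable ?G"
    proof (rule Int_stableI, clarify)
      fix \<phi> \<psi> :: "real^'n \<Rightarrow> real" assume *: "\<phi> \<in> Cc_infinity" "\<psi> \<in> Cc_infinity"
      have "(\<lambda>x. \<phi> x * \<psi> x) \<in> Cc_infinity"
        by (rule Cc_infinity_mult[OF *(1) Cc_infinity_times_differentiable[OF *(2)]])
      moreover have "{x. \<phi> x \<noteq> 0} \<inter> {x. \<psi> x \<noteq> 0} = {x. \<phi> x * \<psi> x \<noteq> 0}" by auto
      ultimately show "\<exists>\<eta>. {x. \<phi> x \<noteq> 0} \<inter> {x. \<psi> x \<noteq> 0} = {x. \<eta> x \<noteq> 0} \<and> \<eta> \<in> Cc_infinity"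
        by (intro exI conjI)
    qed
    have "?G \<subseteq> Pow UNIV" by simp
    from Int_stable this A have "(LINT x:A|\<mu>. ?f x) = 0"
    proof (induction rule: sigma_sets_induct_disjoint)
      case (basic A)
      then obtain \<phi> where \<phi>: "A = {x. \<phi> x \<noteq> 0}" "\<phi> \<in> Cc_infinity" by blast
      \<comment> \<open>Multiplying by this bump cuts the nonzero set of \<phi> down to its part in
        the ball, so the indicator of the ball is absorbed into a test function.\<close>
      let ?b = "ball_bump 0 r"
      have "(\<lambda>x. \<phi> x * ?b x) \<in> Cc_infinity"
        using r by (intro Cc_infinity_mult[OF \<phi>(2)] Cc_infinity_times_differentiable ball_bump_Cc_infinity)
      from supp[OF this]
      have "(\<integral>x. indicator {x. \<phi> x * ?b x \<noteq> 0} x * u x \<partial>\<mu>) = 0" .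
      moreover have "indicator {x. \<phi> x * ?b x \<noteq> 0} x = indicator A x * (indicator (ball 0 r) x :: real)" for x
        using ball_bump_eq_0_iff[OF r, of 0 x] by (simp add: \<phi> indicator_def)
      ultimately show ?case
        by (simp add: set_lebesgue_integral_def mult.assoc)
    next
      case empty
      show ?case by (simp add: set_lebesgue_integral_def)
    next
      case (compl A)
      have A: "A \<in> sets \<mu>"
        using compl(1) unfolding sets borel_eq_Cc_infinity_supports .
      have "indicator {x. ball_bump 0 r x \<noteq> 0} x = (indicator (ball 0 r) x :: real)" for x :: "real^'n"
        using ball_bump_eq_0_iff[OF r, of 0 x] by (simp add: indicator_def)
      then have "(\<integral>x. ?f x \<partial>\<mu>) = 0"
        using supp[OF ball_bump_Cc_infinity[OF r, of 0]] by simp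
      moreover have "(LINT x:UNIV - A|\<mu>. ?f x) = (\<integral>x. ?f x - indicator A x * ?f x \<partial>\<mu>)"
        unfolding set_lebesgue_integral_def by (intro Bochner_Integration.integral_cong) (auto simp: indicator_def)
      moreover have "\<dots> = (\<integral>x. ?f x \<partial>\<mu>) - (\<integral>x. indicator A x * ?f x \<partial>\<mu>)"
        using f f_on[OF A] by (intro Bochner_Integration.integral_diff) (auto simp: set_integrable_def)
      ultimately show ?case
        using compl(2) by (simp add: set_lebesgue_integral_def)
    next
      case (union A)
      have A: "A i \<in> sets \<mu>" for i
        using union(2) unfolding sets borel_eq_Cc_infinity_supports by blast
      have "(LINT x:(\<Union>i. A i)|\<mu>. ?f x) = (\<Sum>i. (LINT x:(A i)|\<mu>. ?f x))"
      proof (rule lebesgue_integral_countable_add)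
        show "A i \<inter> A j = {}" if "i \<noteq> j" for i j
          using union(1) that by (auto simp: disjoint_family_on_def)
        show "set_integrable \<mu> (\<Union>i. A i) ?f"
          using A by (intro f_on) auto
      qed (use A in auto)
      then show ?case using union(3) by simp
    qed
    then show "(LINT x:A|\<mu>. ?f x) = (LINT x:A|\<mu>. 0)" by (simp add: set_lebesgue_integral_def)
  qed simp
  \<comment> \<open>\<open>Suc n\<close> keeps all radii positive while the balls still exhaust the
    space.\<close>
  have "AE x in \<mu>. \<forall>n. indicator (ball 0 (real (Suc n))) x * u x = 0"
    unfolding AE_all_countable using AE_ball by simp
  then show ?thesis
  proof (rule AE_mp, intro AE_I2 impI)
    fix x assume *: "\<forall>n. indicator (ball 0 (real (Suc n))) x * u x = 0"
    obtain n where "norm x < real n" using reals_Archimedean2 by blast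
    then show "u x = 0" using *[rule_format, of n] by simp
  qed
qed

section \<open>Factorisation through a random vector\<close>

text \<open>The Doob-Dynkin factorisation. Nonnegative functions are built up from indicators, for
  which the definition of the generated sigma-algebra supplies the factor; the general case takes
  the difference of the positive and negative parts.\<close>

lemma borel_measurable_vimage_algebra_factor:
  fixes f :: "'a \<Rightarrow> real"
  assumes f: "f \<in> borel_measurable (vimage_algebra \<Omega> V borel)"
  shows "\<exists>g \<in> borel_measurable borel. \<forall>\<omega>\<in>\<Omega>. f \<omega> = g (V \<omega>)"
proof -
  have nonneg: "\<exists>g \<in> borel_measurable borel. \<forall>\<omega>\<in>\<Omega>. h \<omega> = g (V \<omega>)"
    if "h \<in> borel_measurable (vimage_algebra \<Omega> V borel)" "\<And>\<omega>. 0 \<le> h \<omega>" for h :: "'a \<Rightarrow> real"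
    using that
  proof (induction rule: borel_measurable_induct_real)
    case (set A)
    then obtain B where "B \<in> sets borel" "A = V -` B \<inter> \<Omega>"
      by (auto simp: sets_vimage_algebra2)
    then show ?case by (intro bexI[of _ "indicator B"]) (auto simp: indicator_def)
  next
    case (mult u c)
    then obtain g where "g \<in> borel_measurable borel" "\<forall>\<omega>\<in>\<Omega>. u \<omega> = g (V \<omega>)" by blast
    then show ?case by (intro bexI[of _ "\<lambda>y. c * g y"]) auto
  next
    case (add u v)
    then obtain g g' where "g \<in> borel_measurable borel" "\<forall>\<omega>\<in>\<Omega>. u \<omega> = g (V \<omega>)"
      "g' \<in> borel_measurable borel" "\<forall>\<omega>\<in>\<Omega>. v \<omega> = g' (V \<omega>)" by blast
    then show ?case by (intro bexI[of _ "\<lambda>y. g' y + g y"]) auto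
  next
    case (seq U)
    then have "\<forall>i. \<exists>g. g \<in> borel_measurable borel \<and> (\<forall>\<omega>\<in>\<Omega>. U i \<omega> = g (V \<omega>))" by blast
    then obtain g where "\<forall>i. g i \<in> borel_measurable borel \<and> (\<forall>\<omega>\<in>\<Omega>. U i \<omega> = g i (V \<omega>))"
      unfolding choice_iff by blast
    then have g: "\<And>i. g i \<in> borel_measurable borel" "\<And>i \<omega>. \<omega> \<in> \<Omega> \<Longrightarrow> U i \<omega> = g i (V \<omega>)"
      by blast+

    show ?case
    \<comment> \<open>Off the range of \<open>V\<close> the sequence need not converge. There
      \<open>lim\<close> has some unspecified value, but the function stays Borel measurable, and
      only points \<open>V \<omega>\<close> matter.\<close>
    proof (intro bexI[of _ "\<lambda>y. lim (\<lambda>i. g i y)"] ballI)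
      fix \<omega> assume \<omega>: "\<omega> \<in> \<Omega>"
      have "(\<lambda>i. U i \<omega>) \<longlonglongrightarrow> h \<omega>"
        by (rule seq) (simp add: \<omega>)
      then have "(\<lambda>i. g i (V \<omega>)) \<longlonglongrightarrow> h \<omega>"
        by (simp only: g(2)[OF \<omega>])
      then show "h \<omega> = lim (\<lambda>i. g i (V \<omega>))"
        by (rule limI[symmetric])
    next
      show "(\<lambda>y. lim (\<lambda>i. g i y)) \<in> borel_measurable borel"
        using borel_measurable_lim_metric[of g borel, OF g(1)] .
    qed
  qed
  have "(\<lambda>\<omega>. max (f \<omega>) 0) \<in> borel_measurable (vimage_algebra \<Omega> V borel)"
    "(\<lambda>\<omega>. max (- f \<omega>) 0) \<in> borel_measurable (vimage_algebra \<Omega> V borel)"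
    by (intro borel_measurable_max borel_measurable_uminus borel_measurable_const f)+
  note ex = this[THEN nonneg, OF max.cobounded2]
  obtain g where g: "g \<in> borel_measurable borel" "\<forall>\<omega>\<in>\<Omega>. max (f \<omega>) 0 = g (V \<omega>)"
    using ex(1) by blast
  obtain g' where g': "g' \<in> borel_measurable borel" "\<forall>\<omega>\<in>\<Omega>. max (- f \<omega>) 0 = g' (V \<omega>)"
    using ex(2) by blast
  show ?thesis
  proof (intro bexI[of _ "\<lambda>y. g y - g' y"] ballI)
    fix \<omega> assume "\<omega> \<in> \<Omega>"
    then have "g (V \<omega>) - g' (V \<omega>) = max (f \<omega>) 0 - max (- f \<omega>) 0"
      using g(2) g'(2) by simp
    then show "f \<omega> = g (V \<omega>) - g' (V \<omega>)"
      by (simp add: max_def split: if_splits)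
  qed (intro borel_measurable_diff g(1) g'(1))
qed

section \<open>Gaussian integration by parts\<close>

lemma lborel_translation:
  fixes h :: "'a::euclidean_space \<Rightarrow> real"
  assumes "integrable lborel h"
  shows "integrable lborel (\<lambda>x. h (x + c))" "(\<integral>x. h (x + c) \<partial>lborel) = (\<integral>x. h x \<partial>lborel)"
proof -
  have "integrable (distr lborel borel ((+) c)) h"
    using assms by (simp add: lborel_distr_plus)
  then show "integrable lborel (\<lambda>x. h (x + c))"
    by (subst (asm) integrable_distr_eq) (use assms in \<open>auto simp: add.commute\<close>)
  have "(\<integral>x. h x \<partial>lborel) = (\<integral>x. h x \<partial>distr lborel borel ((+) c))"
    by (simp add: lborel_distr_plus)
  also have "\<dots> = (\<integral>x. h (x + c) \<partial>lborel)"
    by (subst integral_distr) (use assms in \<open>auto simp: add.commute\<close>)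
  finally show "(\<integral>x. h (x + c) \<partial>lborel) = (\<integral>x. h x \<partial>lborel)" by simp
qed

lemma lborel_integrable_scaleR:
  fixes f :: "'a::euclidean_space \<Rightarrow> real"
  assumes "integrable lborel f" and c: "c \<noteq> 0"
  shows "integrable lborel (\<lambda>x. f (c *\<^sub>R x))"
proof -
  have f: "f \<in> borel_measurable borel" using assms(1) by auto
  have "(\<integral>\<^sup>+x. norm (f x) \<partial>lborel) < \<infinity>"
    using assms(1) by (simp add: integrable_iff_bounded)
  also have "(\<integral>\<^sup>+x. norm (f x) \<partial>lborel) =
      (\<integral>\<^sup>+x. norm (f x) \<partial>density (distr lborel borel (\<lambda>x. 0 + c *\<^sub>R x)) (\<lambda>_. ennreal (\<bar>c\<bar> ^ DIM('a))))"
    by (subst lborel_affine[OF c, of 0]) simp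
  also have "\<dots> = ennreal (\<bar>c\<bar> ^ DIM('a)) * (\<integral>\<^sup>+x. norm (f (c *\<^sub>R x)) \<partial>lborel)"
    using f by (subst nn_integral_density) (auto simp: nn_integral_distr nn_integral_cmult)
  finally have "(\<integral>\<^sup>+x. norm (f (c *\<^sub>R x)) \<partial>lborel) < \<infinity>"
    using c by (auto simp: ennreal_mult_less_top)
  moreover have "(\<lambda>x. f (c *\<^sub>R x)) \<in> borel_measurable lborel"
    using f by measurable
  ultimately show ?thesis
    by (simp add: integrable_iff_bounded)
qed

text \<open>Difference quotients integrate to \<open>0\<close> by translation invariance.\<close>

lemma integral_directional_derivative_eq_0:
  fixes h :: "'a::euclidean_space \<Rightarrow> real"
  assumes h: "integrable lborel h" and G: "integrable lborel G"
    and D: "\<And>x. (h has_derivative h' x) (at x)"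
    and bound: "\<And>x s. 0 \<le> s \<Longrightarrow> s \<le> 1 \<Longrightarrow> \<bar>h' (x + s *\<^sub>R e) e\<bar> \<le> G x"
  shows "integrable lborel (\<lambda>x. h' x e)" "(\<integral>x. h' x e \<partial>lborel) = 0"
proof -
  have hb: "h \<in> borel_measurable borel" using h by auto
  \<comment> \<open>These steps lie in (0, 1], the range over which \<open>G x\<close> bounds the
    derivative along \<open>e\<close>.\<close>
  define s where "s n = 1 / real (Suc n)" for n
  have s: "0 < s n" "s n \<le> 1" for n by (simp_all add: s_def)
  have s0: "s \<longlonglongrightarrow> 0"
    unfolding s_def[abs_def] using LIMSEQ_inverse_real_of_nat by (simp add: inverse_eq_divide)
  define q where "q n x = (h (x + s n *\<^sub>R e) - h x) / s n" for n x
  have Ds: "((\<lambda>s. h (x + s *\<^sub>R e)) has_real_derivative h' (x + s *\<^sub>R e) e) (at s)" for x s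
  proof -
    have "((\<lambda>s. x + s *\<^sub>R e) has_derivative (\<lambda>s. s *\<^sub>R e)) (at s)"
      by (auto intro!: derivative_eq_intros)
    from diff_chain_at[OF this D]
    have "((\<lambda>s. h (x + s *\<^sub>R e)) has_derivative (\<lambda>t. h' (x + s *\<^sub>R e) (t *\<^sub>R e))) (at s)"
      by (simp add: o_def)
    moreover have "h' (x + s *\<^sub>R e) (t *\<^sub>R e) = h' (x + s *\<^sub>R e) e * t" for t
      using linear_scale[OF has_derivative_linear[OF D]] by simp
    ultimately show ?thesis
      by (simp add: has_field_derivative_def)
  qed
  have lim: "(\<lambda>n. q n x) \<longlonglongrightarrow> h' x e" for x
  proof -
    have "(\<lambda>t. (h (x + t *\<^sub>R e) - h x) / t) \<midarrow>0\<rightarrow> h' x e"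
      using Ds[of x 0] by (simp add: has_field_derivative_iff)
    moreover have "\<forall>n. s n \<noteq> 0" using s(1) by (metis less_irrefl)
    ultimately show ?thesis
      using s0 unfolding q_def LIMSEQ_SEQ_conv[symmetric] by blast
  qed
  have qm: "q n \<in> borel_measurable lborel" for n
    unfolding q_def[abs_def] using hb by measurable
  have D'm: "(\<lambda>x. h' x e) \<in> borel_measurable lborel"
    by (rule borel_measurable_LIMSEQ_real[OF lim qm])
  have qb: "norm (q n x) \<le> G x" for n x
  proof -
    \<comment> \<open>The mean value theorem replaces the quotient by a derivative at a point
      between \<open>x\<close> and \<open>x + e\<close>, where \<open>G x\<close> is a bound that
      does not depend on \<open>n\<close>.\<close>
    obtain z where z: "0 < z" "z < s n" "h (x + s n *\<^sub>R e) - h (x + 0 *\<^sub>R e) = (s n - 0) * h' (x + z *\<^sub>R e) e"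
      using MVT2[OF s(1) Ds] by blast
    then have "q n x = h' (x + z *\<^sub>R e) e"
      using s(1)[of n] by (simp add: q_def)
    moreover have "z \<le> 1" using z s(2)[of n] by linarith
    ultimately show ?thesis using bound[of z x] z(1) by simp
  qed
  have q0: "(\<integral>x. q n x \<partial>lborel) = 0" for n
    unfolding q_def using lborel_translation[OF h, of "s n *\<^sub>R e"] h by simp
  have "AE x in lborel. (\<lambda>n. q n x) \<longlonglongrightarrow> h' x e" "\<And>n. AE x in lborel. norm (q n x) \<le> G x"
    using lim qb by simp_all
  note dc = D'm qm G this
  show "integrable lborel (\<lambda>x. h' x e)"
    by (rule integrable_dominated_convergence[OF dc])
  have "(\<lambda>n. \<integral>x. q n x \<partial>lborel) \<longlonglongrightarrow> (\<integral>x. h' x e \<partial>lborel)"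
    by (rule integral_dominated_convergence[OF dc])
  then show "(\<integral>x. h' x e \<partial>lborel) = 0"
    by (simp add: q0 LIMSEQ_const_iff)
qed

text \<open>The minimum of the quadratic form on the compact unit sphere serves as \<open>a\<close>;
  homogeneity of degree two extends the bound to all vectors.\<close>

lemma positive_definite_lower_bound:
  fixes P :: "real^'n^'n"
  assumes "\<And>x. x \<noteq> 0 \<Longrightarrow> 0 < x \<bullet> (P *v x)"
  obtains a where "a > 0" "\<And>x. a * (norm x)\<^sup>2 \<le> x \<bullet> (P *v x)"
proof -
  have "continuous_on (sphere 0 1) (\<lambda>x. x \<bullet> (P *v x))"
    by (intro continuous_intros linear_continuous_on matrix_vector_mul_bounded_linear)
  moreover have "axis undefined 1 \<in> (sphere 0 1 :: (real^'n) set)" by (simp add: norm_axis_1)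
  ultimately obtain z :: "real^'n" where z: "z \<in> sphere 0 1" "\<And>y. y \<in> sphere 0 1 \<Longrightarrow> z \<bullet> (P *v z) \<le> y \<bullet> (P *v y)"
    using continuous_attains_inf[of "sphere 0 1" "\<lambda>x. x \<bullet> (P *v x)"] compact_sphere by blast
  show thesis
  proof (rule that)
    have "z \<noteq> 0" using z(1) by auto
    then show "0 < z \<bullet> (P *v z)" by (rule assms)
  next
    fix x :: "real^'n"
    show "z \<bullet> (P *v z) * (norm x)\<^sup>2 \<le> x \<bullet> (P *v x)"
    proof (cases "x = 0")
      case False
      define y where "y = (1 / norm x) *\<^sub>R x"
      have "y \<in> sphere 0 1" using False by (simp add: y_def)
      from z(2)[OF this] have "z \<bullet> (P *v z) * (norm x)\<^sup>2 \<le> y \<bullet> (P *v y) * (norm x)\<^sup>2"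
        by (rule mult_right_mono) simp
      also have "\<dots> = x \<bullet> (P *v x)"
        using False by (simp add: y_def matrix_vector_mult_scaleR power2_eq_square)
      finally show ?thesis .
    qed simp
  qed
qed

lemma exp_quadratic_derivative:
  fixes P :: "real^'n^'n"
  assumes "transpose P = P"
  shows "((\<lambda>x. exp (- (x \<bullet> (P *v x)) / 2)) has_derivative
    (\<lambda>e. - ((P *v x) \<bullet> e) * exp (- (x \<bullet> (P *v x)) / 2))) (at x)"
proof -
  have P: "((\<lambda>x. P *v x) has_derivative (\<lambda>e. P *v e)) (at x)"
    by (rule bounded_linear_imp_has_derivative) (rule matrix_vector_mul_bounded_linear)
  have "x \<bullet> (P *v e) = (P *v x) \<bullet> e" for e
    by (metis assms dot_lmul_matrix inner_commute matrix_transpose_mul transpose_matrix_vector)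
  then have "((\<lambda>x. x \<bullet> (P *v x)) has_derivative (\<lambda>e. 2 * ((P *v x) \<bullet> e))) (at x)"
    by (intro has_derivative_eq_rhs[OF has_derivative_inner[OF has_derivative_ident P]])
      (auto simp: fun_eq_iff inner_commute)
  from has_derivative_exp[OF has_derivative_mult_right[OF this, of "- 1 / 2"]] show ?thesis
    by (simp add: mult.commute)
qed

context
  fixes C :: "real^'n^'n"
  assumes P_sym: "transpose (matrix_inv C) = matrix_inv C"
    and P_pos: "\<And>x. x \<noteq> 0 \<Longrightarrow> 0 < x \<bullet> (matrix_inv C *v x)"
    and total: "integrable lborel (\<lambda>x. exp (- (x \<bullet> (matrix_inv C *v x)) / 2))"
begin

text \<open>The quadratic form is at most B |x|^2, so the assumed integrability of its exponential
  gives the claim for the rate B/2. Scaling the variable then reaches any positive rate.\<close>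

lemma integrable_exp_norm_square:
  assumes "a > 0"
  shows "integrable lborel (\<lambda>x::real^'n. exp (- a * (norm x)\<^sup>2))"
proof -
  let ?P = "matrix_inv C"
  obtain B where B: "B > 0" "\<And>x. norm (?P *v x) \<le> norm x * B"
    using bounded_linear.pos_bounded[OF matrix_vector_mul_bounded_linear[of ?P]] by blast
  have le: "x \<bullet> (?P *v x) \<le> B * (norm x)\<^sup>2" for x
  proof -
    have "x \<bullet> (?P *v x) \<le> norm x * norm (?P *v x)" by (rule norm_cauchy_schwarz)
    also have "\<dots> \<le> norm x * (norm x * B)" by (intro mult_left_mono B(2)) simp
    finally show ?thesis by (simp add: power2_eq_square algebra_simps)
  qed
  have "integrable lborel (\<lambda>x::real^'n. exp (- (B / 2) * (norm x)\<^sup>2))"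
  proof (rule Bochner_Integration.integrable_bound[OF total])
    show "AE x in lborel. norm (exp (- (B / 2) * (norm x)\<^sup>2)) \<le> norm (exp (- (x \<bullet> (?P *v x)) / 2))"
      using le by (intro AE_I2) (simp add: field_simps)
  qed measurable
  \<comment> \<open>The scale is chosen so that B/2 times its square equals
    \<open>a\<close>.\<close>
  from lborel_integrable_scaleR[OF this, of "sqrt (2 * a / B)"] show ?thesis
    using assms B(1) by (simp add: power_mult_distrib)
qed

text \<open>A quadratic factor costs half of the exponent: y \<le> exp y with y = (a/2) |x|^2. The
  shift by 2 anticipates domination on the unit ball around x, where 1 + |y| \<le> 2 + |x|.\<close>

lemma integrable_square_exp_norm_square:
  assumes "a > 0"
  shows "integrable lborel (\<lambda>x::real^'n. (2 + norm x)\<^sup>2 * exp (- a * (norm x)\<^sup>2))"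
proof -
  have "integrable lborel (\<lambda>x::real^'n. 8 * exp (- a * (norm x)\<^sup>2) + 4 / a * exp (- (a / 2) * (norm x)\<^sup>2))"
    using assms by (intro Bochner_Integration.integrable_add integrable_mult_right integrable_exp_norm_square) auto
  then show ?thesis
  proof (rule Bochner_Integration.integrable_bound)
    show "AE x in lborel. norm ((2 + norm x)\<^sup>2 * exp (- a * (norm (x::real^'n))\<^sup>2)) \<le>
      norm (8 * exp (- a * (norm x)\<^sup>2) + 4 / a * exp (- (a / 2) * (norm x)\<^sup>2))"
    proof (rule AE_I2)
      fix x :: "real^'n"
      let ?n = "(norm x)\<^sup>2"
      have "(2 + norm x)\<^sup>2 \<le> 8 + 2 * ?n"
        using zero_le_power2[of "2 - norm x"] by (simp add: power2_eq_square algebra_simps)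
      then have "(2 + norm x)\<^sup>2 * exp (- a * ?n) \<le> (8 + 2 * ?n) * exp (- a * ?n)"
        by (rule mult_right_mono) simp
      also have "\<dots> = 8 * exp (- a * ?n) + 2 * (?n * exp (- a * ?n))" by (simp add: algebra_simps)
      also have "?n * exp (- a * ?n) \<le> (2 / a * exp (a / 2 * ?n)) * exp (- a * ?n)"
      proof (rule mult_right_mono)
        have "a / 2 * ?n \<le> exp (a / 2 * ?n)"
          using exp_ge_add_one_self[of "a / 2 * ?n"] by linarith
        then show "?n \<le> 2 / a * exp (a / 2 * ?n)"
          using assms by (simp add: field_simps)
      qed simp
      also have "(2 / a * exp (a / 2 * ?n)) * exp (- a * ?n) = 2 / a * exp (- (a / 2) * ?n)"
        by (simp add: mult.assoc exp_add[symmetric] field_simps)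
      finally show "norm ((2 + norm x)\<^sup>2 * exp (- a * ?n)) \<le>
          norm (8 * exp (- a * ?n) + 4 / a * exp (- (a / 2) * ?n))"
        using assms by (simp add: abs_mult)
    qed
  qed measurable
qed

lemma exp_quadratic_ibp:
  fixes g :: "real^'n \<Rightarrow> real" and Dg :: "real^'n \<Rightarrow> real^'n"
  defines "E \<equiv> \<lambda>x. exp (- (x \<bullet> (matrix_inv C *v x)) / 2)"
  assumes Dg: "\<And>x. (g has_derivative (\<lambda>e. Dg x \<bullet> e)) (at x)"
    and Dg_meas: "(\<lambda>x. Dg x $ i) \<in> borel_measurable borel"
    and bounds: "\<And>x. \<bar>g x\<bar> \<le> B * (1 + norm x)" "\<And>x. norm (Dg x) \<le> B"
  shows "integrable lborel (\<lambda>x. E x * Dg x $ i)"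
    and "integrable lborel (\<lambda>x. E x * (g x * (matrix_inv C *v x) $ i))"
    and "(\<integral>x. E x * Dg x $ i \<partial>lborel) = (\<integral>x. E x * (g x * (matrix_inv C *v x) $ i) \<partial>lborel)"
proof -
  let ?P = "matrix_inv C"
  let ?e = "axis i 1 :: real^'n"
  have B: "0 \<le> B" using order_trans[OF norm_ge_zero bounds(2)] .
  obtain a where a: "a > 0" "\<And>x. a * (norm x)\<^sup>2 \<le> x \<bullet> (?P *v x)"
    by (rule positive_definite_lower_bound[OF P_pos]) (assumption, rule that)
  obtain b where b: "b > 0" "\<And>x. norm (?P *v x) \<le> norm x * b"
    using bounded_linear.pos_bounded[OF matrix_vector_mul_bounded_linear[of ?P]] by blast
  \<comment> \<open>\<open>W x\<close> has to dominate at every y within distance 1 of x. There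
    |x|^2 \<le> 2 |y|^2 + 2, which weakens the rate from a/2 to a/4 at the price of the factor
    exp(a/2). The factor B (1 + b) collects the bounds on Dg and on g times the linear term.\<close>
  define K where "K = B * (1 + b) * exp (a / 2)"
  define W where "W x = K * ((2 + norm x)\<^sup>2 * exp (- (a / 4) * (norm x)\<^sup>2))" for x :: "real^'n"
  have W: "integrable lborel W"
    unfolding W_def[abs_def] using a(1) by (intro integrable_mult_right integrable_square_exp_norm_square) simp
  have bnd: "\<bar>E y\<bar> * (B + B * (2 + norm x) * (b * (2 + norm x))) \<le> W x" if xy: "norm (x - y) \<le> 1" for x y
  proof -
    have "norm x \<le> norm y + 1" using norm_triangle_sub[of x y] xy by linarith
    then have "(norm x)\<^sup>2 \<le> (norm y + 1)\<^sup>2" by (rule power_mono) simp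
    also have "\<dots> \<le> 2 * (norm y)\<^sup>2 + 2"
      using zero_le_power2[of "norm y - 1"] by (simp add: power2_eq_square algebra_simps)
    finally have "a * (norm x)\<^sup>2 \<le> a * (2 * (norm y)\<^sup>2 + 2)"
      using a(1) by simp
    then have "a * (norm x)\<^sup>2 \<le> 2 * (a * (norm y)\<^sup>2) + 2 * a" by (simp add: algebra_simps)
    then have "- (y \<bullet> (?P *v y)) / 2 \<le> a / 2 + - (a / 4) * (norm x)\<^sup>2"
      using a(2)[of y] by (simp add: field_simps)
    then have E: "\<bar>E y\<bar> \<le> exp (a / 2) * exp (- (a / 4) * (norm x)\<^sup>2)"
      by (simp add: E_def exp_add[symmetric])
    have "1 \<le> (2 + norm x)\<^sup>2" by (simp add: power2_eq_square algebra_simps)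
    then have "B * 1 \<le> B * (2 + norm x)\<^sup>2" using B by (rule mult_left_mono)
    then have "B + B * (2 + norm x) * (b * (2 + norm x)) \<le> B * (1 + b) * (2 + norm x)\<^sup>2"
      by (simp add: power2_eq_square algebra_simps)
    then have "\<bar>E y\<bar> * (B + B * (2 + norm x) * (b * (2 + norm x))) \<le>
        (exp (a / 2) * exp (- (a / 4) * (norm x)\<^sup>2)) * (B * (1 + b) * (2 + norm x)\<^sup>2)"
      using E B b(1) by (intro mult_mono) auto
    then show ?thesis by (simp add: W_def K_def algebra_simps)
  qed
  have pt: "\<bar>Dg y $ i\<bar> \<le> B" "\<bar>g y\<bar> \<le> B * (2 + norm x)" "\<bar>(?P *v y) $ i\<bar> \<le> b * (2 + norm x)"
    if xy: "norm (x - y) \<le> 1" for x y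
  proof -
    have y: "norm y \<le> norm x + 1"
      using norm_triangle_sub[of y x] xy by (simp add: norm_minus_commute)
    show "\<bar>Dg y $ i\<bar> \<le> B" using component_le_norm_cart bounds(2) order_trans by blast
    show "\<bar>g y\<bar> \<le> B * (2 + norm x)"
      by (rule order_trans[OF bounds(1)]) (use y B in \<open>auto intro: mult_left_mono\<close>)
    have "\<bar>(?P *v y) $ i\<bar> \<le> norm y * b" using component_le_norm_cart b(2) order_trans by blast
    also have "\<dots> \<le> (2 + norm x) * b" using y b(1) by (intro mult_right_mono) auto
    finally show "\<bar>(?P *v y) $ i\<bar> \<le> b * (2 + norm x)" by (simp add: mult.commute)
  qed
  have g_cont: "continuous_on UNIV g"
    by (rule has_derivative_continuous_on) (rule has_derivative_at_withinI[OF Dg])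
  have P_cont: "continuous_on UNIV (\<lambda>x. ?P *v x)"
    by (rule linear_continuous_on) (rule matrix_vector_mul_bounded_linear)
  have E_cont: "continuous_on UNIV E"
    unfolding E_def by (intro continuous_intros P_cont) auto
  have [measurable]: "g \<in> borel_measurable borel" "E \<in> borel_measurable borel"
    "(\<lambda>x. (?P *v x) $ i) \<in> borel_measurable borel"
    by (intro borel_measurable_continuous_onI g_cont E_cont continuous_intros P_cont)+
  note [measurable] = Dg_meas
  show i1: "integrable lborel (\<lambda>x. E x * Dg x $ i)"
  proof (rule Bochner_Integration.integrable_bound[OF W], measurable, rule AE_I2)
    fix x
    have "\<bar>E x\<bar> * \<bar>Dg x $ i\<bar> \<le> \<bar>E x\<bar> * (B + B * (2 + norm x) * (b * (2 + norm x)))"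
      using pt(1)[of x x] B b(1) by (intro mult_left_mono add_increasing2) auto
    then show "norm (E x * Dg x $ i) \<le> norm (W x)"
      using bnd[of x x] by (simp add: abs_mult)
  qed
  show i2: "integrable lborel (\<lambda>x. E x * (g x * (?P *v x) $ i))"
  proof (rule Bochner_Integration.integrable_bound[OF W], measurable, rule AE_I2)
    fix x
    have "\<bar>g x\<bar> * \<bar>(?P *v x) $ i\<bar> \<le> B * (2 + norm x) * (b * (2 + norm x))"
      using pt(2,3)[of x x] B b(1) by (intro mult_mono) auto
    then have "\<bar>E x\<bar> * (\<bar>g x\<bar> * \<bar>(?P *v x) $ i\<bar>) \<le> \<bar>E x\<bar> * (B + B * (2 + norm x) * (b * (2 + norm x)))"
      using B by (intro mult_left_mono add_increasing) auto
    then show "norm (E x * (g x * (?P *v x) $ i)) \<le> norm (W x)"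
      using bnd[of x x] by (simp add: abs_mult)
  qed
  define h' where "h' x e = g x * (- ((?P *v x) \<bullet> e) * E x) + (Dg x \<bullet> e) * E x" for x e
  have h': "h' x ?e = E x * Dg x $ i - E x * (g x * (?P *v x) $ i)" for x
    by (simp add: h'_def inner_axis algebra_simps)
  have "(\<integral>x. h' x ?e \<partial>lborel) = 0"
  proof (rule integral_directional_derivative_eq_0(2)[OF _ W])
    show "((\<lambda>x. g x * E x) has_derivative h' x) (at x)" for x
      using has_derivative_mult[OF Dg exp_quadratic_derivative[OF P_sym]]
      unfolding h'_def[abs_def] E_def .
    \<comment> \<open>Here the linear factor \<open>?P *v x\<close> is absent, so the constant 1/b
      compensates for the \<open>b\<close> in \<open>bnd\<close>.\<close>
    show "integrable lborel (\<lambda>x. g x * E x)"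
    proof (rule Bochner_Integration.integrable_bound[OF integrable_mult_right[OF W, of "1 / b + 1"]], measurable, rule AE_I2)
      fix x
      have "\<bar>g x\<bar> * 1 \<le> B * (2 + norm x) * (2 + norm x)"
        using pt(2)[of x x] B by (intro mult_mono) auto
      also have "\<dots> \<le> (1 / b + 1) * (B + B * (2 + norm x) * (b * (2 + norm x)))"
        using B b(1) by (simp add: field_simps)
      finally have "\<bar>E x\<bar> * \<bar>g x\<bar> \<le> \<bar>E x\<bar> * ((1 / b + 1) * (B + B * (2 + norm x) * (b * (2 + norm x))))"
        by (intro mult_left_mono) auto
      also have "\<dots> = (1 / b + 1) * (\<bar>E x\<bar> * (B + B * (2 + norm x) * (b * (2 + norm x))))" by simp
      also have "\<dots> \<le> (1 / b + 1) * W x"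
        using bnd[of x x] b(1) by (intro mult_left_mono) auto
      also have "\<dots> \<le> norm ((1 / b + 1) * W x)"
        by simp
      finally show "norm (g x * E x) \<le> norm ((1 / b + 1) * W x)"
        by (simp only: real_norm_def abs_mult mult.commute[of "\<bar>E x\<bar>"])
    qed
    fix x :: "real^'n" and s :: real assume s: "0 \<le> s" "s \<le> 1"
    define y where "y = x + s *\<^sub>R ?e"
    have xy: "norm (x - y) \<le> 1" using s by (simp add: y_def norm_axis_1)
    have "\<bar>h' y ?e\<bar> \<le> \<bar>E y * Dg y $ i\<bar> + \<bar>E y * (g y * (?P *v y) $ i)\<bar>"
      unfolding h' by (rule abs_triangle_ineq4)
    also have "\<dots> = \<bar>E y\<bar> * (\<bar>Dg y $ i\<bar> + \<bar>g y\<bar> * \<bar>(?P *v y) $ i\<bar>)"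
      by (simp add: abs_mult algebra_simps)
    also have "\<dots> \<le> \<bar>E y\<bar> * (B + B * (2 + norm x) * (b * (2 + norm x)))"
      using pt[OF xy] B b(1) by (intro mult_left_mono add_mono mult_mono) auto
    also have "\<dots> \<le> W x" by (rule bnd[OF xy])
    finally show "\<bar>h' (x + s *\<^sub>R ?e) ?e\<bar> \<le> W x" by (simp add: y_def)
  qed
  then show "(\<integral>x. E x * Dg x $ i \<partial>lborel) = (\<integral>x. E x * (g x * (?P *v x) $ i) \<partial>lborel)"
    using i1 i2 by (simp add: h')
qed

end

section \<open>Vector-valued integrals\<close>

lemma sum_axis_component: "(\<Sum>i\<in>UNIV. axis i (v $ i)) = (v :: 'b::comm_monoid_add ^ 'n)"
  by (simp add: vec_eq_iff axis_def if_distrib if_distribR sum.delta cong: if_cong)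

lemma bounded_linear_axis: "bounded_linear (axis i :: 'b::euclidean_space \<Rightarrow> 'b ^ 'n)"
  unfolding linear_conv_bounded_linear[symmetric]
  by (rule linearI) (auto simp: axis_def vec_eq_iff)

text \<open>The entries range over any Euclidean space, so a matrix, being a vector of rows, is
  handled by applying such componentwise criteria twice.\<close>

lemma borel_measurable_vec_iff:
  fixes f :: "'a \<Rightarrow> 'b::euclidean_space ^ 'n"
  shows "f \<in> borel_measurable M \<longleftrightarrow> (\<forall>i. (\<lambda>x. f x $ i) \<in> borel_measurable M)"
proof (intro iffI allI)
  fix i assume "f \<in> borel_measurable M"
  then show "(\<lambda>x. f x $ i) \<in> borel_measurable M"
    by (rule measurable_compose)
      (intro borel_measurable_continuous_onI linear_continuous_on bounded_linear_vec_nth)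
next
  assume comp: "\<forall>i. (\<lambda>x. f x $ i) \<in> borel_measurable M"
  have "(\<lambda>x. \<Sum>i\<in>UNIV. axis i (f x $ i)) \<in> borel_measurable M"
  proof (rule borel_measurable_sum)
    fix i
    show "(\<lambda>x. axis i (f x $ i)) \<in> borel_measurable M"
      by (rule measurable_compose[OF comp[rule_format, of i]])
        (intro borel_measurable_continuous_onI linear_continuous_on bounded_linear_axis)
  qed
  then show "f \<in> borel_measurable M" by (simp add: sum_axis_component)
qed

lemma integrable_vec_iff:
  fixes f :: "'a \<Rightarrow> 'b::euclidean_space ^ 'n"
  shows "integrable M f \<longleftrightarrow> (\<forall>i. integrable M (\<lambda>x. f x $ i))"
proof (intro iffI allI)
  fix i assume "integrable M f"
  then show "integrable M (\<lambda>x. f x $ i)"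
    by (rule integrable_bounded_linear[OF bounded_linear_vec_nth])
next
  assume comp: "\<forall>i. integrable M (\<lambda>x. f x $ i)"
  have "integrable M (\<lambda>x. \<Sum>i\<in>UNIV. axis i (f x $ i))"
    by (intro Bochner_Integration.integrable_sum integrable_bounded_linear[OF bounded_linear_axis]
        comp[rule_format])
  then show "integrable M f" by (simp add: sum_axis_component)
qed

lemma integral_vec_nth:
  fixes f :: "'a \<Rightarrow> 'b::euclidean_space ^ 'n"
  assumes "integrable M f"
  shows "(\<integral>x. f x \<partial>M) $ i = (\<integral>x. f x $ i \<partial>M)"
  using integral_bounded_linear[OF bounded_linear_vec_nth assms, of i] by simp

lemma integrable_mult_square:
  fixes f g :: "'a \<Rightarrow> real"
  assumes "integrable M (\<lambda>x. (f x)\<^sup>2)" "integrable M (\<lambda>x. (g x)\<^sup>2)"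
    and [measurable]: "f \<in> borel_measurable M" "g \<in> borel_measurable M"
  shows "integrable M (\<lambda>x. f x * g x)"
proof (rule Bochner_Integration.integrable_bound[OF Bochner_Integration.integrable_add[OF assms(1,2)]])
  show "AE x in M. norm (f x * g x) \<le> norm ((f x)\<^sup>2 + (g x)\<^sup>2)"
  proof (rule AE_I2)
    fix x
    have "\<bar>f x * g x\<bar> \<le> (f x)\<^sup>2 + (g x)\<^sup>2"
      using zero_le_power2[of "\<bar>f x\<bar> - \<bar>g x\<bar>"] zero_le_power2[of "f x"] zero_le_power2[of "g x"]
      using mult_nonneg_nonneg[OF abs_ge_zero abs_ge_zero, of "f x" "g x"]
      unfolding power2_diff power2_abs abs_mult by linarith
    then show "norm (f x * g x) \<le> norm ((f x)\<^sup>2 + (g x)\<^sup>2)" by simp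
  qed
qed measurable

lemma (in finite_measure) integrable_of_square:
  fixes f :: "'a \<Rightarrow> real"
  assumes "integrable M (\<lambda>x. (f x)\<^sup>2)" "f \<in> borel_measurable M"
  shows "integrable M f"
  using integrable_mult_square[OF assms(1) _ assms(2), of "\<lambda>_. 1"] by simp

lemma integral_vec_sq:
  fixes f :: "'a \<Rightarrow> real^'n"
  assumes "\<And>i. f \<in> borel_measurable M" "\<And>i. integrable M (\<lambda>x. (f x $ i)\<^sup>2)"
  shows "integrable M (\<lambda>x. vec_sq (f x))" "(\<integral>x. vec_sq (f x) \<partial>M) $ i $ j = (\<integral>x. f x $ i * f x $ j \<partial>M)"
proof -
  have m: "(\<lambda>x. f x $ i) \<in> borel_measurable M" for i
    using assms(1) by (simp add: borel_measurable_vec_iff)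
  show *: "integrable M (\<lambda>x. vec_sq (f x))"
    by (simp add: integrable_vec_iff vec_sq_def integrable_mult_square[OF assms(2,2) m m])
  then have "integrable M (\<lambda>x. vec_sq (f x) $ i)"
    by (simp only: integrable_vec_iff) simp
  then show "(\<integral>x. vec_sq (f x) \<partial>M) $ i $ j = (\<integral>x. f x $ i * f x $ j \<partial>M)"
    by (simp add: integral_vec_nth[OF *] integral_vec_nth) (simp add: vec_sq_def)
qed

lemma matrix_inv_of_invertible:
  fixes C :: "real^'n^'n"
  assumes "invertible C"
  shows "C ** matrix_inv C = mat 1" "matrix_inv C ** C = mat 1"
  using someI_ex[OF assms[unfolded invertible_def]] by (simp_all add: matrix_inv_def)

lemma transpose_matrix_inv:
  fixes C :: "real^'n^'n"
  assumes "invertible C" "transpose C = C"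
  shows "transpose (matrix_inv C) = matrix_inv C"
proof -
  let ?P = "matrix_inv C"
  have "transpose ?P ** C = mat 1"
    using matrix_inv_of_invertible(1)[OF assms(1)] assms(2)
    by (metis matrix_transpose_mul transpose_mat)
  then have "transpose ?P ** (C ** ?P) = ?P"
    by (simp add: matrix_mul_assoc)
  then show ?thesis
    by (simp add: matrix_inv_of_invertible(1)[OF assms(1)])
qed

text \<open>By independence the joint law is the product of the marginals, so all three claims are
  Fubini. Freezing X serves the integration by parts in Z, freezing Z serves the Stein identity in
  X, and the last claim serves the integrability of \<tau>(X).\<close>

lemma (in prob_space)
  fixes F :: "'b::second_countable_topology \<Rightarrow> 'b \<Rightarrow> real"
  assumes indep: "indep_var borel X borel Z"
    and F: "(\<lambda>(x, z). F x z) \<in> borel_measurable borel"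
    and int: "integrable M (\<lambda>\<omega>. F (X \<omega>) (Z \<omega>))"
  shows indep_integral_fst: "expectation (\<lambda>\<omega>. F (X \<omega>) (Z \<omega>)) = (\<integral>x. expectation (\<lambda>\<omega>. F x (Z \<omega>)) \<partial>distr M borel X)"
    and indep_integral_snd: "expectation (\<lambda>\<omega>. F (X \<omega>) (Z \<omega>)) = (\<integral>z. expectation (\<lambda>\<omega>. F (X \<omega>) z) \<partial>distr M borel Z)"
    and indep_AE_integrable_snd: "AE z in distr M borel Z. integrable M (\<lambda>\<omega>. F (X \<omega>) z)"
proof -
  have X: "X \<in> borel_measurable M" and Z: "Z \<in> borel_measurable M"
    and eq: "distr M borel X \<Otimes>\<^sub>M distr M borel Z = distr M (borel \<Otimes>\<^sub>M borel) (\<lambda>\<omega>. (X \<omega>, Z \<omega>))"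
    using indep by (simp_all add: indep_var_distribution_eq)
  interpret X: prob_space "distr M borel X" by (rule prob_space_distr[OF X])
  interpret Z: prob_space "distr M borel Z" by (rule prob_space_distr[OF Z])
  interpret XZ: pair_sigma_finite "distr M borel X" "distr M borel Z" ..
  have F': "(\<lambda>(x, z). F x z) \<in> borel_measurable (borel \<Otimes>\<^sub>M borel)"
    using F by (simp add: borel_prod)
  have XZm: "(\<lambda>\<omega>. (X \<omega>, Z \<omega>)) \<in> measurable M (borel \<Otimes>\<^sub>M borel)"
    using X Z by measurable
  have Fx: "(\<lambda>z. F x z) \<in> borel_measurable borel" for x
    using measurable_compose[OF _ F', of "\<lambda>z. (x, z)" borel] by simp
  have Fz: "(\<lambda>x. F x z) \<in> borel_measurable borel" for z
    using measurable_compose[OF _ F', of "\<lambda>x. (x, z)" borel] by simp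
  have int': "integrable (distr M borel X \<Otimes>\<^sub>M distr M borel Z) (\<lambda>(x, z). F x z)"
    unfolding eq using int by (subst integrable_distr_eq[OF XZm F']) simp
  have E: "expectation (\<lambda>\<omega>. F (X \<omega>) (Z \<omega>)) = integral\<^sup>L (distr M borel X \<Otimes>\<^sub>M distr M borel Z) (\<lambda>(x, z). F x z)"
    unfolding eq by (subst integral_distr[OF XZm F']) simp
  show "expectation (\<lambda>\<omega>. F (X \<omega>) (Z \<omega>)) = (\<integral>x. expectation (\<lambda>\<omega>. F x (Z \<omega>)) \<partial>distr M borel X)"
    unfolding E XZ.integral_fst[OF int', symmetric] by (simp add: integral_distr[OF Z Fx])
  show "expectation (\<lambda>\<omega>. F (X \<omega>) (Z \<omega>)) = (\<integral>z. expectation (\<lambda>\<omega>. F (X \<omega>) z) \<partial>distr M borel Z)"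
    unfolding E XZ.integral_snd[OF int', symmetric] by (simp add: integral_distr[OF X Fz])
  show "AE z in distr M borel Z. integrable M (\<lambda>\<omega>. F (X \<omega>) z)"
    using XZ.AE_integrable_snd[OF int'] by (simp add: integrable_distr_eq[OF X Fz])
qed

section \<open>The Gaussian channel\<close>

locale gaussian_channel = prob_space M for M :: "'a measure" +
  fixes X Z :: "'a \<Rightarrow> real^'n" and C :: "real^'n^'n" and t :: real
  assumes X_meas: "X \<in> borel_measurable M"
    and X_norm_square: "integrable M (\<lambda>\<omega>. (norm (X \<omega>))\<^sup>2)"
    and X_centered: "expectation X = 0"
    and X_covariance: "covariance_matrix M X = C"
    and C_invertible: "invertible C"
    and Z_gaussian: "distributed M lborel Z (\<lambda>x. ennreal (gaussian_density C x))"
    and indep: "indep_var borel X borel Z"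
    and t: "0 < t" "t < 1"
begin

abbreviation "P \<equiv> matrix_inv C"
abbreviation "V \<equiv> interp X Z t"
abbreviation "EXV \<equiv> vec_cond_exp M V X"

lemma X_nth_meas [measurable]: "(\<lambda>\<omega>. X \<omega> $ i) \<in> borel_measurable M"
  using X_meas borel_measurable_vec_iff by blast

lemma X_nth_square: "integrable M (\<lambda>\<omega>. (X \<omega> $ i)\<^sup>2)"
proof (rule Bochner_Integration.integrable_bound[OF X_norm_square])
  show "AE \<omega> in M. norm ((X \<omega> $ i)\<^sup>2) \<le> norm ((norm (X \<omega>))\<^sup>2)"
    using component_le_norm_cart[of "X _" i] by (intro AE_I2) (simp add: abs_le_square_iff[symmetric])
qed measurable

lemma X_nth_mult: "integrable M (\<lambda>\<omega>. X \<omega> $ i * X \<omega> $ j)"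
  by (intro integrable_mult_square X_nth_square X_nth_meas)

lemma X_nth_integrable: "integrable M (\<lambda>\<omega>. X \<omega> $ i)"
  by (rule integrable_of_square[OF X_nth_square X_nth_meas])

lemma X_nth_mean: "expectation (\<lambda>\<omega>. X \<omega> $ i) = 0"
proof -
  have "integrable M X" using X_nth_integrable integrable_vec_iff by blast
  from integral_vec_nth[OF this, of i] show ?thesis by (simp add: X_centered)
qed

lemma C_nth: "expectation (\<lambda>\<omega>. X \<omega> $ i * X \<omega> $ j) = C $ i $ j"
  using integral_vec_sq(2)[OF X_meas X_nth_square, of i j]
  unfolding X_covariance[symmetric] covariance_matrix_def X_centered by simp

lemma C_transpose: "transpose C = C"
  by (simp add: vec_eq_iff transpose_def C_nth[symmetric] mult.commute)

lemma C_P: "C ** P = mat 1" and P_C: "P ** C = mat 1"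
  by (rule matrix_inv_of_invertible[OF C_invertible])+

lemma P_transpose: "transpose P = P"
  by (rule transpose_matrix_inv[OF C_invertible C_transpose])

lemma C_mult_P_mult: "C *v (P *v x) = x" and P_mult_C_mult: "P *v (C *v x) = x"
  by (simp_all add: matrix_vector_mul_assoc C_P P_C)

lemma X_inner_mult: "integrable M (\<lambda>\<omega>. X \<omega> $ i * (y \<bullet> X \<omega>))"
  and C_mult_nth: "expectation (\<lambda>\<omega>. X \<omega> $ i * (y \<bullet> X \<omega>)) = (C *v y) $ i"
proof -
  have eq: "X \<omega> $ i * (y \<bullet> X \<omega>) = (\<Sum>j\<in>UNIV. y $ j * (X \<omega> $ i * X \<omega> $ j))" for \<omega>
    by (simp add: inner_vec_def sum_distrib_left algebra_simps)
  show "integrable M (\<lambda>\<omega>. X \<omega> $ i * (y \<bullet> X \<omega>))"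
    unfolding eq by (intro Bochner_Integration.integrable_sum integrable_mult_right X_nth_mult)
  show "expectation (\<lambda>\<omega>. X \<omega> $ i * (y \<bullet> X \<omega>)) = (C *v y) $ i"
    unfolding eq matrix_vector_mult_def
    by (simp add: Bochner_Integration.integral_sum X_nth_mult C_nth) (simp only: mult.commute)
qed

text \<open>With x = C y the quadratic form equals E[(y . X)^2]. Were it 0, then y . X would vanish
  almost surely, and so would C y = E[X (y . X)], which is x.\<close>

lemma P_pos:
  assumes "x \<noteq> 0"
  shows "0 < x \<bullet> (P *v x)"
proof -
  define y where "y = P *v x"
  have x: "x = C *v y" by (simp add: y_def C_mult_P_mult)
  have eq: "(y \<bullet> X \<omega>)\<^sup>2 = (\<Sum>i\<in>UNIV. y $ i * (X \<omega> $ i * (y \<bullet> X \<omega>)))" for \<omega>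
  proof -
    have "(y \<bullet> X \<omega>)\<^sup>2 = (\<Sum>i\<in>UNIV. y $ i * X \<omega> $ i) * (y \<bullet> X \<omega>)"
      by (simp add: power2_eq_square inner_vec_def)
    then show ?thesis by (simp add: sum_distrib_right mult.assoc)
  qed
  have int: "integrable M (\<lambda>\<omega>. (y \<bullet> X \<omega>)\<^sup>2)"
    unfolding eq by (intro Bochner_Integration.integrable_sum integrable_mult_right X_inner_mult)
  have E: "expectation (\<lambda>\<omega>. (y \<bullet> X \<omega>)\<^sup>2) = x \<bullet> y"
  proof -
    have "expectation (\<lambda>\<omega>. \<Sum>i\<in>UNIV. y $ i * (X \<omega> $ i * (y \<bullet> X \<omega>))) =
        (\<Sum>i\<in>UNIV. expectation (\<lambda>\<omega>. y $ i * (X \<omega> $ i * (y \<bullet> X \<omega>))))"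
      by (intro Bochner_Integration.integral_sum integrable_mult_right X_inner_mult)
    also have "\<dots> = (\<Sum>i\<in>UNIV. y $ i * x $ i)"
      by (simp only: integral_mult_right_zero C_mult_nth x)
    finally show ?thesis
      unfolding eq by (simp add: inner_vec_def mult.commute)
  qed
  have "x \<bullet> y \<noteq> 0"
  proof
    assume "x \<bullet> y = 0"
    then have "AE \<omega> in M. (y \<bullet> X \<omega>)\<^sup>2 = 0"
      using E integral_nonneg_eq_0_iff_AE[OF int] by simp
    then have "AE \<omega> in M. X \<omega> $ i * (y \<bullet> X \<omega>) = 0" for i
      by (rule AE_mp) simp
    then have "expectation (\<lambda>\<omega>. X \<omega> $ i * (y \<bullet> X \<omega>)) = 0" for i
      by (rule integral_eq_zero_AE)
    then have "x = 0" by (simp add: vec_eq_iff x C_mult_nth[symmetric])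
    with assms show False by simp
  qed
  moreover have "0 \<le> x \<bullet> y"
    unfolding E[symmetric] by (rule integral_nonneg_AE) simp
  ultimately show ?thesis by (simp add: y_def)
qed

section \<open>The Gaussian density and the moments of Z\<close>

definition "norm_const = sqrt ((2 * pi) ^ CARD('n) * det C)"

text \<open>Positivity of \<open>norm_const\<close>, hence of \<open>det C\<close>, is read off from the total mass of the
  density.\<close>

lemma gaussian_density_eq: "gaussian_density C x = (1 / norm_const) * exp (- (x \<bullet> (P *v x)) / 2)"
  by (simp add: gaussian_density_def norm_const_def)

lemma Z_meas: "Z \<in> borel_measurable M"
  using distributed_measurable[OF Z_gaussian] by simp

lemma gaussian_density_nn_integral: "(\<integral>\<^sup>+x. ennreal (gaussian_density C x) \<partial>lborel) = 1"
proof -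
  have "prob_space (density lborel (\<lambda>x. ennreal (gaussian_density C x)))"
    unfolding distributed_distr_eq_density[OF Z_gaussian, symmetric]
    by (rule prob_space_distr[OF distributed_measurable[OF Z_gaussian]])
  then show ?thesis
    using prob_space.emeasure_space_1 distributed_borel_measurable[OF Z_gaussian]
    by (fastforce simp: emeasure_density)
qed

lemma norm_const_pos: "0 < norm_const"
proof (rule ccontr)
  assume "\<not> 0 < norm_const"
  \<comment> \<open>Two conventions enter: the square root of a negative number is negative, and
    division by zero gives 0. In either case \<open>ennreal\<close> truncates the density to 0,
    against its total mass 1.\<close>
  then have "gaussian_density C x \<le> 0" for x
    by (simp add: gaussian_density_eq field_simps divide_nonneg_nonpos)
  then have "(\<integral>\<^sup>+x. ennreal (gaussian_density C x) \<partial>lborel) = 0"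
    by (simp add: ennreal_neg)
  then show False by (simp add: gaussian_density_nn_integral)
qed

lemma gaussian_density_pos: "0 < gaussian_density C x"
  using norm_const_pos by (simp add: gaussian_density_eq)

lemma exp_quadratic_integrable: "integrable lborel (\<lambda>x. exp (- (x \<bullet> (P *v x)) / 2))"
proof -
  have "continuous_on UNIV (\<lambda>x. P *v x)"
    by (rule linear_continuous_on) (rule matrix_vector_mul_bounded_linear)
  then have "continuous_on UNIV (\<lambda>x. gaussian_density C x)"
    unfolding gaussian_density_eq by (intro continuous_intros) auto
  then have "gaussian_density C \<in> borel_measurable borel"
    by (rule borel_measurable_continuous_onI)
  then have "integrable lborel (gaussian_density C)"
    using gaussian_density_nn_integral less_imp_le[OF gaussian_density_pos]
    by (intro integrableI_nn_integral_finite[where x = 1]) auto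
  then have "integrable lborel (\<lambda>x. norm_const * gaussian_density C x)"
    by (rule integrable_mult_right)
  then show ?thesis
    using norm_const_pos by (simp add: gaussian_density_eq)
qed

lemma gaussian_ibp:
  fixes g :: "real^'n \<Rightarrow> real" and Dg :: "real^'n \<Rightarrow> real^'n"
  assumes Dg: "\<And>x. (g has_derivative (\<lambda>e. Dg x \<bullet> e)) (at x)"
    and Dg_meas: "(\<lambda>x. Dg x $ i) \<in> borel_measurable borel"
    and bounds: "\<And>x. \<bar>g x\<bar> \<le> B * (1 + norm x)" "\<And>x. norm (Dg x) \<le> B"
  shows "integrable M (\<lambda>\<omega>. Dg (Z \<omega>) $ i)"
    and "integrable M (\<lambda>\<omega>. g (Z \<omega>) * (P *v Z \<omega>) $ i)"
    and "expectation (\<lambda>\<omega>. Dg (Z \<omega>) $ i) = expectation (\<lambda>\<omega>. g (Z \<omega>) * (P *v Z \<omega>) $ i)"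
proof -
  note ibp = exp_quadratic_ibp[OF P_transpose P_pos exp_quadratic_integrable Dg Dg_meas bounds]
  have "continuous_on UNIV (\<lambda>x. P *v x)"
    by (rule linear_continuous_on) (rule matrix_vector_mul_bounded_linear)
  moreover have "continuous_on UNIV g"
    by (rule has_derivative_continuous_on) (rule has_derivative_at_withinI[OF Dg])
  ultimately have "continuous_on UNIV (\<lambda>x. g x * (P *v x) $ i)"
    by (intro continuous_intros)
  then have gP: "(\<lambda>x. g x * (P *v x) $ i) \<in> borel_measurable lborel"
    by (simp add: borel_measurable_continuous_onI)
  have D: "(\<lambda>x. Dg x $ i) \<in> borel_measurable lborel"
    using Dg_meas by simp
  note nonneg = less_imp_le[OF gaussian_density_pos]
  show "integrable M (\<lambda>\<omega>. Dg (Z \<omega>) $ i)"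
    using integrable_mult_right[OF ibp(1), of "1 / norm_const"]
    unfolding distributed_integrable[OF Z_gaussian D nonneg, symmetric] gaussian_density_eq
    by (simp add: mult.assoc)
  show "integrable M (\<lambda>\<omega>. g (Z \<omega>) * (P *v Z \<omega>) $ i)"
    using integrable_mult_right[OF ibp(2), of "1 / norm_const"]
    unfolding distributed_integrable[OF Z_gaussian gP nonneg, symmetric] gaussian_density_eq
    by (simp add: mult.assoc)
  show "expectation (\<lambda>\<omega>. Dg (Z \<omega>) $ i) = expectation (\<lambda>\<omega>. g (Z \<omega>) * (P *v Z \<omega>) $ i)"
    unfolding distributed_integral[OF Z_gaussian D nonneg, symmetric]
      distributed_integral[OF Z_gaussian gP nonneg, symmetric] gaussian_density_eq
    using ibp(3) by (simp add: mult.assoc)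
qed

text \<open>Integration by parts applied to the constant function 1.\<close>

lemma PZ_integrable: "integrable M (\<lambda>\<omega>. (P *v Z \<omega>) $ i)"
  and PZ_mean: "expectation (\<lambda>\<omega>. (P *v Z \<omega>) $ i) = 0"
proof -
  have "((\<lambda>x. 1) has_derivative (\<lambda>e. (0::real^'n) \<bullet> e)) (at x)" for x :: "real^'n" by simp
  note ibp = gaussian_ibp[OF this, of i 1, simplified]
  show "integrable M (\<lambda>\<omega>. (P *v Z \<omega>) $ i)" "expectation (\<lambda>\<omega>. (P *v Z \<omega>) $ i) = 0"
    using ibp by simp_all
qed

text \<open>Integration by parts applied to the j-th coordinate function, whose gradient is a unit
  vector. Multiplying by C turns this into the covariance of Z.\<close>

lemma Z_PZ_integrable: "integrable M (\<lambda>\<omega>. Z \<omega> $ j * (P *v Z \<omega>) $ i)"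
  and Z_PZ_expectation: "expectation (\<lambda>\<omega>. Z \<omega> $ j * (P *v Z \<omega>) $ i) = (if i = j then 1 else 0)"
proof -
  have D: "((\<lambda>x. x $ j) has_derivative (\<lambda>e. axis j 1 \<bullet> e)) (at x)" for x :: "real^'n"
    using bounded_linear_imp_has_derivative[OF bounded_linear_vec_nth, of j] by (simp add: inner_axis')
  have b: "\<bar>x $ j\<bar> \<le> 1 * (1 + norm x)" for x :: "real^'n"
    using component_le_norm_cart[of x j] by simp
  have n: "norm (axis j 1 :: real^'n) \<le> 1" by (simp add: norm_axis_1)
  note ibp = gaussian_ibp[OF D borel_measurable_const b n, of i]
  show "integrable M (\<lambda>\<omega>. Z \<omega> $ j * (P *v Z \<omega>) $ i)" by (rule ibp(2))
  show "expectation (\<lambda>\<omega>. Z \<omega> $ j * (P *v Z \<omega>) $ i) = (if i = j then 1 else 0)"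
    using ibp(3) by (simp add: axis_def prob_space)
qed

lemma Z_nth_eq: "Z \<omega> $ i = (\<Sum>k\<in>UNIV. C $ i $ k * (P *v Z \<omega>) $ k)"
  using arg_cong[OF C_mult_P_mult[of "Z \<omega>"], of "\<lambda>v. v $ i"]
  by (subst (asm) matrix_vector_mult_def) simp

lemma Z_nth_integrable: "integrable M (\<lambda>\<omega>. Z \<omega> $ i)"
  unfolding Z_nth_eq by (intro Bochner_Integration.integrable_sum integrable_mult_right PZ_integrable)

lemma Z_nth_mean: "expectation (\<lambda>\<omega>. Z \<omega> $ i) = 0"
  unfolding Z_nth_eq by (simp add: Bochner_Integration.integral_sum PZ_integrable PZ_mean)

lemma Z_nth_mult: "integrable M (\<lambda>\<omega>. Z \<omega> $ i * Z \<omega> $ j)"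
  and Z_nth_covariance: "expectation (\<lambda>\<omega>. Z \<omega> $ i * Z \<omega> $ j) = C $ i $ j"
proof -
  have eq: "Z \<omega> $ i * Z \<omega> $ j = (\<Sum>k\<in>UNIV. C $ i $ k * (Z \<omega> $ j * (P *v Z \<omega>) $ k))" for \<omega>
    by (subst Z_nth_eq[of \<omega> i]) (simp add: sum_distrib_left sum_distrib_right algebra_simps)
  show "integrable M (\<lambda>\<omega>. Z \<omega> $ i * Z \<omega> $ j)"
    unfolding eq by (intro Bochner_Integration.integrable_sum integrable_mult_right Z_PZ_integrable)
  show "expectation (\<lambda>\<omega>. Z \<omega> $ i * Z \<omega> $ j) = C $ i $ j"
    unfolding eq by (simp add: Bochner_Integration.integral_sum Z_PZ_integrable Z_PZ_expectation if_distrib cong: if_cong)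
qed

lemma Z_nth_square: "integrable M (\<lambda>\<omega>. (Z \<omega> $ i)\<^sup>2)"
  using Z_nth_mult[of i i] by (simp add: power2_eq_square)

lemma Z_nth_meas [measurable]: "(\<lambda>\<omega>. Z \<omega> $ i) \<in> borel_measurable M"
  using Z_meas borel_measurable_vec_iff by blast

section \<open>Moments of V\<close>

lemma indep_real:
  fixes f g :: "real^'n \<Rightarrow> real"
  assumes "f \<in> borel_measurable borel" "g \<in> borel_measurable borel"
  shows "indep_var borel (\<lambda>\<omega>. f (X \<omega>)) borel (\<lambda>\<omega>. g (Z \<omega>))"
  using indep_var_compose[OF indep assms] by (simp add: o_def)

lemma vec_nth_borel: "(\<lambda>x::real^'n. x $ i) \<in> borel_measurable borel"
  by (intro borel_measurable_continuous_onI linear_continuous_on bounded_linear_vec_nth)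

lemma X_Z_mult: "integrable M (\<lambda>\<omega>. X \<omega> $ i * Z \<omega> $ j)"
  by (intro integrable_mult_square X_nth_square Z_nth_square X_nth_meas Z_nth_meas)

lemma X_Z_expectation: "expectation (\<lambda>\<omega>. X \<omega> $ i * Z \<omega> $ j) = 0"
  using indep_var_lebesgue_integral[OF indep_real[OF vec_nth_borel vec_nth_borel] X_nth_integrable Z_nth_integrable]
  by (simp add: X_nth_mean)

lemma V_nth: "V \<omega> $ i = sqrt t * X \<omega> $ i + sqrt (1 - t) * Z \<omega> $ i"
  by (simp add: interp_def)

lemma V_meas: "V \<in> borel_measurable M"
  unfolding borel_measurable_vec_iff V_nth by measurable

lemma V_nth_meas [measurable]: "(\<lambda>\<omega>. V \<omega> $ i) \<in> borel_measurable M"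
  using V_meas borel_measurable_vec_iff by blast

lemma V_nth_integrable: "integrable M (\<lambda>\<omega>. V \<omega> $ i)"
  unfolding V_nth by (intro Bochner_Integration.integrable_add integrable_mult_right X_nth_integrable Z_nth_integrable)

lemma X_V_mult: "integrable M (\<lambda>\<omega>. X \<omega> $ i * V \<omega> $ j)"
  and X_V_expectation: "expectation (\<lambda>\<omega>. X \<omega> $ i * V \<omega> $ j) = sqrt t * C $ i $ j"
proof -
  have eq: "X \<omega> $ i * V \<omega> $ j = sqrt t * (X \<omega> $ i * X \<omega> $ j) + sqrt (1 - t) * (X \<omega> $ i * Z \<omega> $ j)" for \<omega>
    by (simp add: V_nth algebra_simps)
  note i = integrable_mult_right[OF X_nth_mult, of "sqrt t"] integrable_mult_right[OF X_Z_mult, of "sqrt (1 - t)"]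
  show "integrable M (\<lambda>\<omega>. X \<omega> $ i * V \<omega> $ j)"
    unfolding eq by (intro Bochner_Integration.integrable_add i)
  show "expectation (\<lambda>\<omega>. X \<omega> $ i * V \<omega> $ j) = sqrt t * C $ i $ j"
    unfolding eq Bochner_Integration.integral_add[OF i] by (simp add: C_nth X_Z_expectation)
qed

lemma V_V_mult: "integrable M (\<lambda>\<omega>. V \<omega> $ i * V \<omega> $ j)"
  and V_V_expectation: "expectation (\<lambda>\<omega>. V \<omega> $ i * V \<omega> $ j) = C $ i $ j"
proof -
  have eq: "V \<omega> $ i * V \<omega> $ j = sqrt t * (X \<omega> $ i * V \<omega> $ j) +
      (sqrt (1 - t) * sqrt t * (X \<omega> $ j * Z \<omega> $ i) + (1 - t) * (Z \<omega> $ i * Z \<omega> $ j))" for \<omega>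
  proof -
    have sq: "sqrt (1 - t) * sqrt (1 - t) = 1 - t" using t by simp
    have "(a * x + b * z) * (a * x' + b * z') = a * (x * (a * x' + b * z')) + (b * a * (x' * z) + b * b * (z * z'))"
      for a b x x' z z' :: real
      by (simp add: algebra_simps)
    then have "V \<omega> $ i * V \<omega> $ j = sqrt t * (X \<omega> $ i * V \<omega> $ j) +
        (sqrt (1 - t) * sqrt t * (X \<omega> $ j * Z \<omega> $ i) + sqrt (1 - t) * sqrt (1 - t) * (Z \<omega> $ i * Z \<omega> $ j))"
      unfolding V_nth .
    then show ?thesis unfolding sq .
  qed
  note i = integrable_mult_right[OF X_V_mult, of "sqrt t"]
    integrable_mult_right[OF X_Z_mult, of "sqrt (1 - t) * sqrt t"]
    integrable_mult_right[OF Z_nth_mult, of "1 - t"]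
  note i' = Bochner_Integration.integrable_add[OF i(2,3)]
  show "integrable M (\<lambda>\<omega>. V \<omega> $ i * V \<omega> $ j)"
    unfolding eq by (intro Bochner_Integration.integrable_add i)
  have "sqrt t * sqrt t = t" using t by simp
  then show "expectation (\<lambda>\<omega>. V \<omega> $ i * V \<omega> $ j) = C $ i $ j"
    unfolding eq Bochner_Integration.integral_add[OF i(1) i'] Bochner_Integration.integral_add[OF i(2,3)]
    by (simp only: integral_mult_right_zero X_V_expectation X_Z_expectation Z_nth_covariance)
      (simp add: mult.assoc[symmetric], simp add: algebra_simps)
qed

lemma V_nth_square: "integrable M (\<lambda>\<omega>. (V \<omega> $ i)\<^sup>2)"
  using V_V_mult[of i i] by (simp add: power2_eq_square)

text \<open>X and Z have the same covariance and the weights t and 1 - t add up to 1. Hence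
  \<open>P\<close> standardises V for every t, both in the Fisher information matrix and in
  \<open>J_st\<close>.\<close>

lemma V_covariance: "covariance_matrix M V = C"
proof -
  have "integrable M V" using V_nth_integrable integrable_vec_iff by blast
  from integral_vec_nth[OF this] have EV: "expectation V = 0"
    by (simp add: vec_eq_iff V_nth X_nth_integrable Z_nth_integrable X_nth_mean Z_nth_mean)
  then show ?thesis
    using integral_vec_sq(2)[OF V_meas V_nth_square]
    unfolding covariance_matrix_def EV by (simp add: vec_eq_iff V_V_expectation)
qed

end

section \<open>Conditional expectation given V and second moments\<close>

lemma vec_sq_matrix_mult:
  fixes A :: "real^'n^'m"
  shows "vec_sq (A *v y) = A ** vec_sq y ** transpose A"
proof -
  have "(\<Sum>k\<in>UNIV. A $ i $ k * y $ k) * (\<Sum>l\<in>UNIV. A $ j $ l * y $ l) =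
      (\<Sum>l\<in>UNIV. (\<Sum>k\<in>UNIV. A $ i $ k * (y $ k * y $ l)) * A $ j $ l)" for i j
    by (subst sum_product, subst sum.swap) (simp add: sum_distrib_left sum_distrib_right ac_simps)
  then show ?thesis
    by (simp add: vec_eq_iff vec_sq_def matrix_vector_mult_def matrix_matrix_mult_def transpose_def)
qed

lemma linear_matrix_conjugation:
  fixes A :: "real^'n^'n"
  shows "linear (\<lambda>S. c *\<^sub>R (A ** S ** transpose A))"
  by (rule linearI)
    (simp_all add: vec_eq_iff matrix_matrix_mult_def distrib_left distrib_right sum.distrib
      sum_distrib_left sum_distrib_right mult.left_commute mult.assoc)

context gaussian_channel
begin

lemma C_nth_commute: "C $ i $ j = C $ j $ i"
  by (simp only: C_nth[symmetric] mult.commute)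

abbreviation "\<F> \<equiv> vimage_algebra (space M) V borel"

lemma V_\<F>: "V \<in> measurable \<F> borel"
  by (rule measurable_vimage_algebra1) simp

lemma subalgebra_\<F>: "subalgebra M \<F>"
  using sets_image_in_sets[OF refl V_meas] by (simp add: subalgebra_def)

lemma sigma_finite_subalgebra_\<F>: "sigma_finite_subalgebra M \<F>"
  by (intro finite_measure_subalgebra_is_sigma_finite finite_measure_subalgebra.intro
      finite_measure_subalgebra_axioms.intro subalgebra_\<F> finite_measure_axioms)

interpretation cond: sigma_finite_subalgebra M \<F>
  by (rule sigma_finite_subalgebra_\<F>)

text \<open>Doob-Dynkin in each component. It holds at every point of the space, and it supplies the
  Borel functions of V to which the uniqueness principle applies.\<close>

lemma vec_cond_exp_factor:
  fixes U :: "'a \<Rightarrow> real^'m"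
  shows "\<exists>u. u \<in> borel_measurable borel \<and> (\<forall>\<omega>\<in>space M. vec_cond_exp M V U \<omega> = u (V \<omega>))"
proof -
  have "\<exists>g\<in>borel_measurable borel.
      \<forall>\<omega>\<in>space M. real_cond_exp M \<F> (\<lambda>\<omega>. U \<omega> $ i) \<omega> = g (V \<omega>)" for i
    by (rule borel_measurable_vimage_algebra_factor[OF borel_measurable_cond_exp])
  then have "\<forall>i. \<exists>g. g \<in> borel_measurable borel \<and>
      (\<forall>\<omega>\<in>space M. real_cond_exp M \<F> (\<lambda>\<omega>. U \<omega> $ i) \<omega> = g (V \<omega>))"
    unfolding Bex_def by (rule allI)
  then obtain g where g: "\<forall>i. g i \<in> borel_measurable borel \<and>
      (\<forall>\<omega>\<in>space M. real_cond_exp M \<F> (\<lambda>\<omega>. U \<omega> $ i) \<omega> = g i (V \<omega>))"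
    unfolding choice_iff by blast
  show ?thesis
  proof (intro exI[of _ "\<lambda>v. \<chi> i. g i v"] conjI ballI)
    show "(\<lambda>v. \<chi> i. g i v) \<in> borel_measurable borel"
      using g by (simp add: borel_measurable_vec_iff)
    show "vec_cond_exp M V U \<omega> = (\<chi> i. g i (V \<omega>))" if "\<omega> \<in> space M" for \<omega>
      using g that by (simp add: vec_cond_exp_def vec_eq_iff)
  qed
qed

lemma vec_cond_exp_test:
  fixes U :: "'a \<Rightarrow> real^'m"
  assumes "h \<in> borel_measurable borel" "(\<lambda>\<omega>. U \<omega> $ i) \<in> borel_measurable M"
    "integrable M (\<lambda>\<omega>. h (V \<omega>) * U \<omega> $ i)"
  shows "integrable M (\<lambda>\<omega>. h (V \<omega>) * vec_cond_exp M V U \<omega> $ i)"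
    "expectation (\<lambda>\<omega>. h (V \<omega>) * vec_cond_exp M V U \<omega> $ i) = expectation (\<lambda>\<omega>. h (V \<omega>) * U \<omega> $ i)"
  using cond.real_cond_exp_intg[OF assms(3) measurable_compose[OF V_\<F> assms(1)] assms(2)]
  by (simp_all add: vec_cond_exp_def)

lemma EXV_nth_meas [measurable]: "(\<lambda>\<omega>. EXV \<omega> $ i) \<in> borel_measurable M"
  by (simp add: vec_cond_exp_def)

text \<open>Conditional Jensen for the convex function x^2.\<close>

lemma EXV_nth_square: "integrable M (\<lambda>\<omega>. (EXV \<omega> $ i)\<^sup>2)"
proof -
  have "convex_on UNIV (\<lambda>x::real. x\<^sup>2)" by (rule convex_power2)
  from cond.integrable_convex_cond_exp[OF X_nth_integrable _ _ X_nth_square this, of i]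
  show ?thesis by (simp add: vec_cond_exp_def)
qed

lemma EXV_mult: "integrable M (\<lambda>\<omega>. EXV \<omega> $ i * EXV \<omega> $ j)"
  by (rule integrable_mult_square[OF EXV_nth_square EXV_nth_square EXV_nth_meas EXV_nth_meas])

lemma EXV_X_mult: "integrable M (\<lambda>\<omega>. EXV \<omega> $ i * X \<omega> $ j)"
  by (rule integrable_mult_square[OF EXV_nth_square X_nth_square EXV_nth_meas X_nth_meas])

lemma EXV_V_mult: "integrable M (\<lambda>\<omega>. V \<omega> $ i * EXV \<omega> $ j)"
  by (rule integrable_mult_square[OF V_nth_square EXV_nth_square V_nth_meas EXV_nth_meas])

text \<open>The projection property: the i-th component of E[X | V] is a Borel function of V, hence
  an admissible weight in the defining property of the j-th one.\<close>

lemma EXV_X_expectation: "expectation (\<lambda>\<omega>. EXV \<omega> $ i * X \<omega> $ j) = expectation (\<lambda>\<omega>. EXV \<omega> $ i * EXV \<omega> $ j)"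
proof -
  obtain u where u: "u \<in> borel_measurable borel" "\<forall>\<omega>\<in>space M. EXV \<omega> = u (V \<omega>)"
    using vec_cond_exp_factor[of X] by blast
  have ui: "(\<lambda>v. u v $ i) \<in> borel_measurable borel"
    using u(1) borel_measurable_vec_iff by blast
  have "integrable M (\<lambda>\<omega>. u (V \<omega>) $ i * X \<omega> $ j)"
    using EXV_X_mult by (rule Bochner_Integration.integrable_cong[OF refl, THEN iffD1, rotated]) (simp add: u(2))
  from vec_cond_exp_test(2)[OF ui X_nth_meas this]
  have "expectation (\<lambda>\<omega>. u (V \<omega>) $ i * EXV \<omega> $ j) = expectation (\<lambda>\<omega>. u (V \<omega>) $ i * X \<omega> $ j)" .
  moreover have "expectation (\<lambda>\<omega>. u (V \<omega>) $ i * EXV \<omega> $ j) = expectation (\<lambda>\<omega>. EXV \<omega> $ i * EXV \<omega> $ j)"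
    by (rule Bochner_Integration.integral_cong) (simp_all add: u(2))
  moreover have "expectation (\<lambda>\<omega>. u (V \<omega>) $ i * X \<omega> $ j) = expectation (\<lambda>\<omega>. EXV \<omega> $ i * X \<omega> $ j)"
    by (rule Bochner_Integration.integral_cong) (simp_all add: u(2))
  ultimately show ?thesis by simp
qed

lemma EXV_V_expectation: "expectation (\<lambda>\<omega>. V \<omega> $ i * EXV \<omega> $ j) = sqrt t * C $ i $ j"
proof -
  have "expectation (\<lambda>\<omega>. V \<omega> $ i * EXV \<omega> $ j) = expectation (\<lambda>\<omega>. V \<omega> $ i * X \<omega> $ j)"
    using X_V_mult[of j i] by (intro vec_cond_exp_test vec_nth_borel X_nth_meas) (simp add: mult.commute)
  also have "\<dots> = expectation (\<lambda>\<omega>. X \<omega> $ j * V \<omega> $ i)"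
    by (simp only: mult.commute)
  also have "\<dots> = sqrt t * C $ i $ j"
    by (simp only: X_V_expectation C_nth_commute[of j i])
  finally show ?thesis .
qed

lemma MMSE_nth: "MMSE M X Z t $ i $ j = C $ i $ j - expectation (\<lambda>\<omega>. EXV \<omega> $ i * EXV \<omega> $ j)"
proof -
  have eq: "(X \<omega> - EXV \<omega>) $ i * (X \<omega> - EXV \<omega>) $ j = (X \<omega> $ i * X \<omega> $ j - EXV \<omega> $ i * X \<omega> $ j) -
      (EXV \<omega> $ j * X \<omega> $ i - EXV \<omega> $ i * EXV \<omega> $ j)" for \<omega> i j
    by (simp add: algebra_simps)
  note int = Bochner_Integration.integrable_diff[OF X_nth_mult EXV_X_mult]
    Bochner_Integration.integrable_diff[OF EXV_X_mult EXV_mult]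
  have i: "integrable M (\<lambda>\<omega>. (X \<omega> - EXV \<omega>) $ i * (X \<omega> - EXV \<omega>) $ j)" for i j
    unfolding eq by (rule Bochner_Integration.integrable_diff[OF int])
  have m: "(\<lambda>\<omega>. X \<omega> - EXV \<omega>) \<in> borel_measurable M"
    unfolding borel_measurable_vec_iff by simp
  have "MMSE M X Z t $ i $ j = expectation (\<lambda>\<omega>. (X \<omega> - EXV \<omega>) $ i * (X \<omega> - EXV \<omega>) $ j)"
    unfolding MMSE_def by (rule integral_vec_sq(2)[OF m]) (simp add: power2_eq_square i del: vector_minus_component)
  also have "\<dots> = C $ i $ j - expectation (\<lambda>\<omega>. EXV \<omega> $ i * EXV \<omega> $ j)"
    unfolding eq Bochner_Integration.integral_diff[OF int] Bochner_Integration.integral_diff[OF X_nth_mult EXV_X_mult]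
      Bochner_Integration.integral_diff[OF EXV_X_mult EXV_mult] C_nth EXV_X_expectation
    by (simp add: mult.commute)
  finally show ?thesis .
qed

text \<open>The excess of the best estimate of X over the best linear one: since E[X V^T] = sqrt t C
  and V has covariance C, the linear estimate of X from V is sqrt t V.\<close>

definition "Y \<omega> = EXV \<omega> - sqrt t *\<^sub>R V \<omega>"

lemma Y_nth: "Y \<omega> $ i = EXV \<omega> $ i - sqrt t * V \<omega> $ i"
  by (simp add: Y_def)

lemma Y_meas: "Y \<in> borel_measurable M"
  unfolding borel_measurable_vec_iff Y_nth by measurable

text \<open>The two cross terms contribute -2 t C and the square of sqrt t V contributes t C, so
  E[Y Y^T] is the second moment of E[X | V] minus t C.\<close>

lemma Y_mult: "integrable M (\<lambda>\<omega>. Y \<omega> $ i * Y \<omega> $ j)"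
  and Y_expectation: "expectation (\<lambda>\<omega>. Y \<omega> $ i * Y \<omega> $ j) = (1 - t) * C $ i $ j - MMSE M X Z t $ i $ j"
proof -
  have tt: "sqrt t * sqrt t = t" using t by simp
  have eq: "Y \<omega> $ i * Y \<omega> $ j = (EXV \<omega> $ i * EXV \<omega> $ j - sqrt t * (V \<omega> $ i * EXV \<omega> $ j)) -
      (sqrt t * (V \<omega> $ j * EXV \<omega> $ i) - sqrt t * sqrt t * (V \<omega> $ i * V \<omega> $ j))" for \<omega> i j
    by (simp add: Y_nth algebra_simps)
  note i = EXV_mult integrable_mult_right[OF EXV_V_mult, of "sqrt t"]
     integrable_mult_right[OF EXV_V_mult, of "sqrt t"] integrable_mult_right[OF V_V_mult, of "sqrt t * sqrt t"]
  note d = Bochner_Integration.integrable_diff[OF i(1,2)] Bochner_Integration.integrable_diff[OF i(3,4)]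
  show "integrable M (\<lambda>\<omega>. Y \<omega> $ i * Y \<omega> $ j)"
    unfolding eq by (rule Bochner_Integration.integrable_diff[OF d])
  show "expectation (\<lambda>\<omega>. Y \<omega> $ i * Y \<omega> $ j) = (1 - t) * C $ i $ j - MMSE M X Z t $ i $ j"
    unfolding eq Bochner_Integration.integral_diff[OF d] Bochner_Integration.integral_diff[OF i(1,2)]
      Bochner_Integration.integral_diff[OF i(3,4)] integral_mult_right_zero EXV_V_expectation V_V_expectation MMSE_nth
      C_nth_commute[of j i]
    by (simp add: mult.assoc[symmetric] tt abs_of_pos[OF t(1)]) (simp add: algebra_simps)
qed

lemma Y_nth_square: "integrable M (\<lambda>\<omega>. (Y \<omega> $ i)\<^sup>2)"
  using Y_mult[of i i] by (simp add: power2_eq_square)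

lemma Y_nth_integrable: "integrable M (\<lambda>\<omega>. Y \<omega> $ i)"
  by (rule integrable_of_square[OF Y_nth_square]) (use Y_meas borel_measurable_vec_iff in blast)

lemma vec_sq_Y: "(\<integral>\<omega>. vec_sq (Y \<omega>) \<partial>M) = (1 - t) *\<^sub>R C - MMSE M X Z t"
  by (simp add: vec_eq_iff integral_vec_sq(2)[OF Y_meas Y_nth_square] Y_expectation)

lemma vec_sq_scaled_P_Y:
  "(\<integral>\<omega>. vec_sq (c *\<^sub>R (P *v Y \<omega>)) \<partial>M) = c\<^sup>2 *\<^sub>R (P ** ((1 - t) *\<^sub>R C - MMSE M X Z t) ** P)"
proof -
  let ?L = "\<lambda>S. c\<^sup>2 *\<^sub>R (P ** S ** transpose P)"
  have "vec_sq (c *\<^sub>R (P *v Y \<omega>)) = c\<^sup>2 *\<^sub>R vec_sq (P *v Y \<omega>)" for \<omega>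
    by (simp add: vec_sq_def vec_eq_iff power2_eq_square)
  then have "vec_sq (c *\<^sub>R (P *v Y \<omega>)) = ?L (vec_sq (Y \<omega>))" for \<omega>
    by (simp only: vec_sq_matrix_mult)
  moreover have "bounded_linear ?L"
    using linear_matrix_conjugation linear_conv_bounded_linear by blast
  from integral_bounded_linear[OF this integral_vec_sq(1)[OF Y_meas Y_nth_square]]
  have "(\<integral>\<omega>. ?L (vec_sq (Y \<omega>)) \<partial>M) = ?L (\<integral>\<omega>. vec_sq (Y \<omega>) \<partial>M)" .
  ultimately show ?thesis by (simp only: vec_sq_Y P_transpose)
qed

section \<open>Integration by parts against test functions of V\<close>

lemma Cc_grad_nth_borel:
  fixes \<phi> :: "real^'n \<Rightarrow> real"
  assumes "\<phi> \<in> Cc_infinity"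
  shows "(\<lambda>x. grad \<phi> x $ i) \<in> borel_measurable borel"
  using measurable_compose[OF borel_measurable_continuous_onI[OF Cc_infinity_grad_continuous[OF assms]] vec_nth_borel] .

lemma Cc_mult_integrable:
  fixes f :: "'a \<Rightarrow> real"
  assumes \<phi>: "\<phi> \<in> Cc_infinity" and f: "integrable M f"
  shows "integrable M (\<lambda>\<omega>. \<phi> (V \<omega>) * f \<omega>)" "integrable M (\<lambda>\<omega>. grad \<phi> (V \<omega>) $ i * f \<omega>)"
proof -
  obtain B where B: "B > 0" "\<And>x. \<bar>\<phi> x\<bar> \<le> B" "\<And>x. norm (grad \<phi> x) \<le> B"
    by (rule Cc_infinity_bounded[OF \<phi>]) (rule that)
  have *: "integrable M (\<lambda>\<omega>. h (V \<omega>) * f \<omega>)"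
    if "h \<in> borel_measurable borel" "\<And>x. \<bar>h x\<bar> \<le> B" for h :: "real^'n \<Rightarrow> real"
  proof (rule Bochner_Integration.integrable_bound[OF integrable_mult_right[OF f, of B]])
    show "(\<lambda>\<omega>. h (V \<omega>) * f \<omega>) \<in> borel_measurable M"
      using measurable_compose[OF V_meas that(1)] f by measurable
    have "\<bar>h (V \<omega>)\<bar> * \<bar>f \<omega>\<bar> \<le> \<bar>B\<bar> * \<bar>f \<omega>\<bar>" for \<omega>
      using that(2)[of "V \<omega>"] by (intro mult_right_mono) auto
    then show "AE \<omega> in M. norm (h (V \<omega>) * f \<omega>) \<le> norm (B * f \<omega>)"
      by (simp add: abs_mult)
  qed
  show "integrable M (\<lambda>\<omega>. \<phi> (V \<omega>) * f \<omega>)"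
    by (rule *[OF Cc_infinity_borel[OF \<phi>] B(2)])
  have "\<bar>grad \<phi> x $ i\<bar> \<le> B" for x
    using component_le_norm_cart B(3) order_trans by blast
  then show "integrable M (\<lambda>\<omega>. grad \<phi> (V \<omega>) $ i * f \<omega>)"
    by (rule *[OF Cc_grad_nth_borel[OF \<phi>]])
qed

lemma fst_snd_borel:
  fixes w :: "real^'n \<Rightarrow> real"
  assumes "w \<in> borel_measurable borel"
  shows "(\<lambda>p. w (fst p)) \<in> borel_measurable (borel :: ((real^'n) \<times> (real^'n)) measure)"
    "(\<lambda>p. w (snd p)) \<in> borel_measurable (borel :: ((real^'n) \<times> (real^'n)) measure)"
    "(\<lambda>p. w (a *\<^sub>R fst p + b *\<^sub>R snd p)) \<in> borel_measurable (borel :: ((real^'n) \<times> (real^'n)) measure)"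
  by (intro measurable_compose[OF _ assms] borel_measurable_continuous_onI continuous_intros)+

text \<open>With X frozen at x the weight is a constant, and Gaussian integration by parts applies
  to z \<mapsto> \<phi>(sqrt t x + sqrt (1 - t) z), whose gradient carries the factor sqrt (1 - t).
  The weight 1 is used for the score, the entries of \<tau> for the Stein side.\<close>

lemma weighted_ibp:
  fixes w :: "real^'n \<Rightarrow> real"
  assumes w: "w \<in> borel_measurable borel" "integrable M (\<lambda>\<omega>. w (X \<omega>))" and \<phi>: "\<phi> \<in> Cc_infinity"
  shows "expectation (\<lambda>\<omega>. \<phi> (V \<omega>) * (w (X \<omega>) * (P *v Z \<omega>) $ i)) =
    sqrt (1 - t) * expectation (\<lambda>\<omega>. grad \<phi> (V \<omega>) $ i * w (X \<omega>))"
proof -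
  obtain B where B: "B > 0" "\<And>x. \<bar>\<phi> x\<bar> \<le> B" "\<And>x. norm (grad \<phi> x) \<le> B"
    by (rule Cc_infinity_bounded[OF \<phi>]) (rule that)
  have PZ: "(\<lambda>z. (P *v z) $ i) \<in> borel_measurable borel"
    by (rule measurable_compose[OF _ vec_nth_borel])
      (intro borel_measurable_continuous_onI linear_continuous_on matrix_vector_mul_bounded_linear)
  have wPZ: "integrable M (\<lambda>\<omega>. w (X \<omega>) * (P *v Z \<omega>) $ i)"
    by (rule indep_var_integrable[OF indep_real[OF w(1) PZ] w(2) PZ_integrable])
  let ?F = "\<lambda>x z. \<phi> (sqrt t *\<^sub>R x + sqrt (1 - t) *\<^sub>R z) * (w x * (P *v z) $ i)"
  let ?G = "\<lambda>x z. sqrt (1 - t) * (grad \<phi> (sqrt t *\<^sub>R x + sqrt (1 - t) *\<^sub>R z) $ i * w x)"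
  have F: "(\<lambda>(x, z). ?F x z) \<in> borel_measurable borel"
    unfolding split_beta
    by (intro borel_measurable_times fst_snd_borel(3)[OF Cc_infinity_borel[OF \<phi>]]
        fst_snd_borel(1)[OF w(1)] fst_snd_borel(2)[OF PZ])
  have G: "(\<lambda>(x, z). ?G x z) \<in> borel_measurable borel"
    unfolding split_beta
    by (intro borel_measurable_times borel_measurable_const fst_snd_borel(3)[OF Cc_grad_nth_borel[OF \<phi>]]
        fst_snd_borel(1)[OF w(1)])
  have iF: "integrable M (\<lambda>\<omega>. ?F (X \<omega>) (Z \<omega>))"
    using Cc_mult_integrable(1)[OF \<phi> wPZ] by (simp add: interp_def)
  have iG: "integrable M (\<lambda>\<omega>. ?G (X \<omega>) (Z \<omega>))"
    using integrable_mult_right[OF Cc_mult_integrable(2)[OF \<phi> w(2)], of "sqrt (1 - t)" i] by (simp add: interp_def)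
  have "expectation (\<lambda>\<omega>. ?F x (Z \<omega>)) = expectation (\<lambda>\<omega>. ?G x (Z \<omega>))" for x
  proof -
    define g where "g z = \<phi> (sqrt (1 - t) *\<^sub>R z + sqrt t *\<^sub>R x)" for z
    define Dg where "Dg z = sqrt (1 - t) *\<^sub>R grad \<phi> (sqrt (1 - t) *\<^sub>R z + sqrt t *\<^sub>R x)" for z
    have "g differentiable (at z)" for z
      unfolding g_def[abs_def] by (rule differentiable_affine[OF Cc_infinity_differentiable[OF \<phi>]])
    then have "(g has_derivative (\<lambda>e. grad g z \<bullet> e)) (at z)" for z
      by (rule has_derivative_grad)
    moreover have "grad g z = Dg z" for z
      unfolding g_def[abs_def] Dg_def by (rule grad_affine[OF Cc_infinity_differentiable[OF \<phi>]])
    ultimately have D: "(g has_derivative (\<lambda>e. Dg z \<bullet> e)) (at z)" for z by simp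
    have "continuous_on UNIV (\<lambda>z. Dg z $ i)"
      unfolding Dg_def
      by (intro continuous_intros continuous_on_compose2[OF Cc_infinity_grad_continuous[OF \<phi>]]) auto
    then have Dm: "(\<lambda>z. Dg z $ i) \<in> borel_measurable borel"
      by (rule borel_measurable_continuous_onI)
    have b1: "\<bar>g z\<bar> \<le> B * (1 + norm z)" for z
    proof -
      have "\<bar>g z\<bar> \<le> B * 1" using B(2) by (simp add: g_def)
      also have "\<dots> \<le> B * (1 + norm z)" using B(1) by (intro mult_left_mono) auto
      finally show ?thesis .
    qed
    have b2: "norm (Dg z) \<le> B" for z
    proof -
      have "sqrt (1 - t) \<le> 1" using t by simp
      then have "sqrt (1 - t) * norm (grad \<phi> (sqrt (1 - t) *\<^sub>R z + sqrt t *\<^sub>R x)) \<le> 1 * B"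
        using B t by (intro mult_mono) auto
      then show ?thesis using t by (simp add: Dg_def)
    qed
    have "expectation (\<lambda>\<omega>. g (Z \<omega>) * (P *v Z \<omega>) $ i) = expectation (\<lambda>\<omega>. Dg (Z \<omega>) $ i)"
      using gaussian_ibp(3)[OF D Dm b1 b2] by simp
    then have "w x * expectation (\<lambda>\<omega>. g (Z \<omega>) * (P *v Z \<omega>) $ i) = w x * expectation (\<lambda>\<omega>. Dg (Z \<omega>) $ i)"
      by simp
    then show ?thesis
      unfolding integral_mult_right_zero[symmetric] by (simp add: g_def Dg_def ac_simps)
  qed
  then have "expectation (\<lambda>\<omega>. ?F (X \<omega>) (Z \<omega>)) = expectation (\<lambda>\<omega>. ?G (X \<omega>) (Z \<omega>))"
    unfolding indep_integral_fst[OF indep F iF] indep_integral_fst[OF indep G iG] by simp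
  then show ?thesis by (simp add: interp_def)
qed

text \<open>With Z frozen at z, the map x \<mapsto> \<phi>(sqrt t x + sqrt (1 - t) z) is again a
  test function, with gradient scaled by sqrt t, so the Stein identity applies for each z.
  Integrable entries of \<tau>(X) are what allows averaging over z.\<close>

lemma stein_shift:
  assumes stein: "is_stein_matrix M X \<tau>" and int: "\<And>i j. integrable M (\<lambda>\<omega>. \<tau> (X \<omega>) $ i $ j)"
    and \<phi>: "\<phi> \<in> Cc_infinity"
  shows "sqrt t * (\<Sum>j\<in>UNIV. expectation (\<lambda>\<omega>. grad \<phi> (V \<omega>) $ j * \<tau> (X \<omega>) $ i $ j)) =
    expectation (\<lambda>\<omega>. \<phi> (V \<omega>) * X \<omega> $ i)"
proof -
  have \<tau>: "(\<lambda>x. \<tau> x $ i $ j) \<in> borel_measurable borel" for i j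
    using stein unfolding is_stein_matrix_def by (simp add: borel_measurable_vec_iff)
  let ?F = "\<lambda>x z. sqrt t * (\<Sum>j\<in>UNIV. grad \<phi> (sqrt t *\<^sub>R x + sqrt (1 - t) *\<^sub>R z) $ j * \<tau> x $ i $ j)"
  let ?G = "\<lambda>x z. \<phi> (sqrt t *\<^sub>R x + sqrt (1 - t) *\<^sub>R z) * x $ i"
  have F: "(\<lambda>(x, z). ?F x z) \<in> borel_measurable borel"
    unfolding split_beta
    by (intro borel_measurable_times borel_measurable_sum borel_measurable_const
        fst_snd_borel(3)[OF Cc_grad_nth_borel[OF \<phi>]] fst_snd_borel(1)[OF \<tau>])
  have G: "(\<lambda>(x, z). ?G x z) \<in> borel_measurable borel"
    unfolding split_beta
    by (intro borel_measurable_times fst_snd_borel(3)[OF Cc_infinity_borel[OF \<phi>]]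
        fst_snd_borel(1)[OF vec_nth_borel])
  have i: "integrable M (\<lambda>\<omega>. grad \<phi> (V \<omega>) $ j * \<tau> (X \<omega>) $ i $ j)" for j
    by (rule Cc_mult_integrable(2)[OF \<phi> int])
  have "integrable M (\<lambda>\<omega>. sqrt t * (\<Sum>j\<in>UNIV. grad \<phi> (V \<omega>) $ j * \<tau> (X \<omega>) $ i $ j))"
    by (intro integrable_mult_right Bochner_Integration.integrable_sum i)
  then have iF: "integrable M (\<lambda>\<omega>. ?F (X \<omega>) (Z \<omega>))"
    by (simp add: interp_def)
  have iG: "integrable M (\<lambda>\<omega>. ?G (X \<omega>) (Z \<omega>))"
    using Cc_mult_integrable(1)[OF \<phi> X_nth_integrable[of i]] by (simp add: interp_def)
  have "expectation (\<lambda>\<omega>. ?F (X \<omega>) z) = expectation (\<lambda>\<omega>. ?G (X \<omega>) z)" for z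
  proof -
    define \<psi> where "\<psi> x = \<phi> (sqrt t *\<^sub>R x + sqrt (1 - t) *\<^sub>R z)" for x
    have \<psi>: "\<psi> \<in> Cc_infinity"
      unfolding \<psi>_def[abs_def] using t by (intro Cc_infinity_affine[OF \<phi>]) simp
    have grad: "grad \<psi> x = sqrt t *\<^sub>R grad \<phi> (sqrt t *\<^sub>R x + sqrt (1 - t) *\<^sub>R z)" for x
      unfolding \<psi>_def[abs_def] by (rule grad_affine[OF Cc_infinity_differentiable[OF \<phi>]])
    have S: "integrable M (\<lambda>\<omega>. \<tau> (X \<omega>) *v grad \<psi> (X \<omega>))"
      "(\<integral>\<omega>. \<tau> (X \<omega>) *v grad \<psi> (X \<omega>) \<partial>M) = (\<integral>\<omega>. \<psi> (X \<omega>) *\<^sub>R X \<omega> \<partial>M)"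
      using stein \<psi> unfolding is_stein_matrix_def by blast+
    have \<psi>m: "(\<lambda>\<omega>. \<psi> (X \<omega>)) \<in> borel_measurable M"
      by (rule measurable_compose[OF X_meas Cc_infinity_borel[OF \<psi>]])
    obtain B where B: "B > 0" "\<And>x. \<bar>\<psi> x\<bar> \<le> B" "\<And>x. norm (grad \<psi> x) \<le> B"
      by (rule Cc_infinity_bounded[OF \<psi>]) (rule that)
    \<comment> \<open>The Stein identity asserts integrability of its left side only; passing to
      components on the right side needs it as well.\<close>
    have "integrable M (\<lambda>\<omega>. \<psi> (X \<omega>) * X \<omega> $ k)" for k
    proof (rule Bochner_Integration.integrable_bound[OF integrable_mult_right[OF X_nth_integrable[of k], of B]])
      show "(\<lambda>\<omega>. \<psi> (X \<omega>) * X \<omega> $ k) \<in> borel_measurable M"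
        using \<psi>m by measurable
      have "\<bar>\<psi> (X \<omega>)\<bar> * \<bar>X \<omega> $ k\<bar> \<le> \<bar>B\<bar> * \<bar>X \<omega> $ k\<bar>" for \<omega>
        using B(2)[of "X \<omega>"] by (intro mult_right_mono) auto
      then show "AE \<omega> in M. norm (\<psi> (X \<omega>) * X \<omega> $ k) \<le> norm (B * X \<omega> $ k)"
        by (simp add: abs_mult)
    qed
    then have S2: "integrable M (\<lambda>\<omega>. \<psi> (X \<omega>) *\<^sub>R X \<omega>)"
      by (simp add: integrable_vec_iff)
    have "expectation (\<lambda>\<omega>. (\<tau> (X \<omega>) *v grad \<psi> (X \<omega>)) $ i) = expectation (\<lambda>\<omega>. (\<psi> (X \<omega>) *\<^sub>R X \<omega>) $ i)"
      using S(2) integral_vec_nth[OF S(1), of i] integral_vec_nth[OF S2, of i] by simp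
    then show ?thesis
      by (simp add: grad matrix_vector_mult_def \<psi>_def sum_distrib_left ac_simps)
  qed
  then have "expectation (\<lambda>\<omega>. ?F (X \<omega>) (Z \<omega>)) = expectation (\<lambda>\<omega>. ?G (X \<omega>) (Z \<omega>))"
    unfolding indep_integral_snd[OF indep F iF] indep_integral_snd[OF indep G iG] by simp
  moreover have "expectation (\<lambda>\<omega>. ?F (X \<omega>) (Z \<omega>)) =
      sqrt t * (\<Sum>j\<in>UNIV. expectation (\<lambda>\<omega>. grad \<phi> (V \<omega>) $ j * \<tau> (X \<omega>) $ i $ j))"
  proof -
    have "expectation (\<lambda>\<omega>. \<Sum>j\<in>UNIV. grad \<phi> (V \<omega>) $ j * \<tau> (X \<omega>) $ i $ j) =
        (\<Sum>j\<in>UNIV. expectation (\<lambda>\<omega>. grad \<phi> (V \<omega>) $ j * \<tau> (X \<omega>) $ i $ j))"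
      by (rule Bochner_Integration.integral_sum[OF i])
    then show ?thesis by (simp add: interp_def)
  qed
  ultimately show ?thesis by (simp add: interp_def)
qed

lemma V_AE_unique:
  assumes u: "u \<in> borel_measurable borel"
    and int: "\<And>\<phi>. \<phi> \<in> Cc_infinity \<Longrightarrow> integrable M (\<lambda>\<omega>. \<phi> (V \<omega>) * u (V \<omega>))"
    and zero: "\<And>\<phi>. \<phi> \<in> Cc_infinity \<Longrightarrow> expectation (\<lambda>\<omega>. \<phi> (V \<omega>) * u (V \<omega>)) = 0"
  shows "AE \<omega> in M. u (V \<omega>) = 0"
proof -
  have m: "(\<lambda>x. \<phi> x * u x) \<in> borel_measurable borel" if "\<phi> \<in> Cc_infinity" for \<phi>
    by (rule borel_measurable_times[OF Cc_infinity_borel[OF that] u])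
  have "AE x in distr M borel V. u x = 0"
  proof (rule Cc_infinity_AE_zero[OF sets_distr u])
    fix \<phi> :: "real^'n \<Rightarrow> real" assume \<phi>: "\<phi> \<in> Cc_infinity"
    show "integrable (distr M borel V) (\<lambda>x. \<phi> x * u x)"
      using int[OF \<phi>] by (simp add: integrable_distr_eq[OF V_meas m[OF \<phi>]])
    show "(\<integral>x. \<phi> x * u x \<partial>distr M borel V) = 0"
      using zero[OF \<phi>] by (simp add: integral_distr[OF V_meas m[OF \<phi>]])
  qed
  then show ?thesis
    using u by (subst (asm) AE_distr_iff[OF V_meas]) (auto intro!: borel_measurable_eq)
qed

lemma P_mult_nth: "(P *v y) $ i = (\<Sum>k\<in>UNIV. P $ i $ k * y $ k)"
  by (simp add: matrix_vector_mult_def)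

text \<open>Against a function of V the conditional expectation may be dropped, so Y gives way to X
  - sqrt t V, an explicit linear combination of X and Z.\<close>

lemma P_Y_test:
  assumes \<phi>: "\<phi> \<in> Cc_infinity"
  shows "integrable M (\<lambda>\<omega>. \<phi> (V \<omega>) * (P *v Y \<omega>) $ i)"
    "integrable M (\<lambda>\<omega>. \<phi> (V \<omega>) * (P *v (X \<omega> - sqrt t *\<^sub>R V \<omega>)) $ i)"
    "expectation (\<lambda>\<omega>. \<phi> (V \<omega>) * (P *v Y \<omega>) $ i) =
      expectation (\<lambda>\<omega>. \<phi> (V \<omega>) * (P *v (X \<omega> - sqrt t *\<^sub>R V \<omega>)) $ i)"
proof -
  define D where "D \<omega> = X \<omega> - sqrt t *\<^sub>R V \<omega>" for \<omega>
  have D_int: "integrable M (\<lambda>\<omega>. D \<omega> $ k)" for k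
    unfolding D_def by (simp add: X_nth_integrable V_nth_integrable)
  have iY: "integrable M (\<lambda>\<omega>. P $ i $ k * (\<phi> (V \<omega>) * Y \<omega> $ k))" for k
    by (intro integrable_mult_right Cc_mult_integrable(1)[OF \<phi>] Y_nth_integrable)
  have iD: "integrable M (\<lambda>\<omega>. P $ i $ k * (\<phi> (V \<omega>) * D \<omega> $ k))" for k
    by (intro integrable_mult_right Cc_mult_integrable(1)[OF \<phi>] D_int)
  have eq: "\<phi> (V \<omega>) * (P *v y) $ i = (\<Sum>k\<in>UNIV. P $ i $ k * (\<phi> (V \<omega>) * y $ k))" for \<omega> y
    by (simp add: P_mult_nth sum_distrib_left ac_simps)
  have "integrable M (\<lambda>\<omega>. \<phi> (V \<omega>) * (P *v Y \<omega>) $ i)" "integrable M (\<lambda>\<omega>. \<phi> (V \<omega>) * (P *v D \<omega>) $ i)"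
    unfolding eq by (intro Bochner_Integration.integrable_sum iY iD)+
  then show "integrable M (\<lambda>\<omega>. \<phi> (V \<omega>) * (P *v Y \<omega>) $ i)"
    "integrable M (\<lambda>\<omega>. \<phi> (V \<omega>) * (P *v (X \<omega> - sqrt t *\<^sub>R V \<omega>)) $ i)"
    by (simp_all add: D_def)
  have "expectation (\<lambda>\<omega>. \<phi> (V \<omega>) * Y \<omega> $ k) = expectation (\<lambda>\<omega>. \<phi> (V \<omega>) * D \<omega> $ k)" for k
  proof -
    note iX = Cc_mult_integrable(1)[OF \<phi> X_nth_integrable[of k]]
    note iV = integrable_mult_right[OF Cc_mult_integrable(1)[OF \<phi> V_nth_integrable[of k]], of "sqrt t"]
    note E = vec_cond_exp_test[OF Cc_infinity_borel[OF \<phi>] X_nth_meas iX]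
    have "expectation (\<lambda>\<omega>. \<phi> (V \<omega>) * Y \<omega> $ k) =
        expectation (\<lambda>\<omega>. \<phi> (V \<omega>) * EXV \<omega> $ k - sqrt t * (\<phi> (V \<omega>) * V \<omega> $ k))"
      by (simp add: Y_nth right_diff_distrib ac_simps)
    also have "\<dots> = expectation (\<lambda>\<omega>. \<phi> (V \<omega>) * X \<omega> $ k - sqrt t * (\<phi> (V \<omega>) * V \<omega> $ k))"
      unfolding Bochner_Integration.integral_diff[OF E(1) iV] Bochner_Integration.integral_diff[OF iX iV] E(2) ..
    also have "\<dots> = expectation (\<lambda>\<omega>. \<phi> (V \<omega>) * D \<omega> $ k)"
      by (simp add: D_def right_diff_distrib ac_simps)
    finally show ?thesis .
  qed
  then have "expectation (\<lambda>\<omega>. \<phi> (V \<omega>) * (P *v Y \<omega>) $ i) = expectation (\<lambda>\<omega>. \<phi> (V \<omega>) * (P *v D \<omega>) $ i)"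
    unfolding eq Bochner_Integration.integral_sum[OF iY] Bochner_Integration.integral_sum[OF iD]
      integral_mult_right_zero by simp
  then show "expectation (\<lambda>\<omega>. \<phi> (V \<omega>) * (P *v Y \<omega>) $ i) =
      expectation (\<lambda>\<omega>. \<phi> (V \<omega>) * (P *v (X \<omega> - sqrt t *\<^sub>R V \<omega>)) $ i)"
    by (simp add: D_def)
qed

section \<open>The score of V and its Fisher information distance\<close>

lemma PZ_test:
  assumes \<phi>: "\<phi> \<in> Cc_infinity"
  shows "expectation (\<lambda>\<omega>. \<phi> (V \<omega>) * (P *v Z \<omega>) $ i) = sqrt (1 - t) * expectation (\<lambda>\<omega>. grad \<phi> (V \<omega>) $ i)"
  using weighted_ibp[of "\<lambda>_. 1", OF borel_measurable_const _ \<phi>, of i] by simp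

lemma Cc_grad_integrable:
  assumes \<phi>: "\<phi> \<in> Cc_infinity"
  shows "integrable M (\<lambda>\<omega>. grad \<phi> (V \<omega>))"
  using Cc_mult_integrable(2)[OF \<phi>, of "\<lambda>_. 1"] by (simp add: integrable_vec_iff)

text \<open>Integration by parts suggests the score -P E[Z | V] / sqrt (1 - t). Eliminating Z
  through V = sqrt t X + sqrt (1 - t) Z turns it into the stated expression in Y, which is taken as
  the definition.\<close>

lemma score_exists:
  obtains \<rho> where "is_score M V \<rho>"
    "\<And>\<omega>. \<omega> \<in> space M \<Longrightarrow> \<rho> (V \<omega>) + P *v V \<omega> = (sqrt t / (1 - t)) *\<^sub>R (P *v Y \<omega>)"
proof -
  obtain u where u: "u \<in> borel_measurable borel" "\<forall>\<omega>\<in>space M. EXV \<omega> = u (V \<omega>)"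
    using vec_cond_exp_factor[of X] by blast
  define \<rho> where "\<rho> v = (sqrt t / (1 - t)) *\<^sub>R (P *v (u v - sqrt t *\<^sub>R v)) - P *v v" for v
  have Pm: "(\<lambda>v. P *v v) \<in> borel_measurable borel"
    by (intro borel_measurable_continuous_onI linear_continuous_on matrix_vector_mul_bounded_linear)
  have \<rho>_meas: "\<rho> \<in> borel_measurable borel"
    unfolding \<rho>_def[abs_def]
    by (intro borel_measurable_diff borel_measurable_scaleR borel_measurable_const Pm
        measurable_compose[OF _ Pm] u(1)) auto
  have \<rho>: "\<rho> (V \<omega>) = (sqrt t / (1 - t)) *\<^sub>R (P *v Y \<omega>) - P *v V \<omega>" if "\<omega> \<in> space M" for \<omega>
    using u(2) that by (simp add: \<rho>_def Y_def)
  have "is_score M V \<rho>"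
    unfolding is_score_def
  proof (intro conjI ballI \<rho>_meas)
    fix \<phi> :: "real^'n \<Rightarrow> real" assume \<phi>: "\<phi> \<in> Cc_infinity"
    let ?c = "sqrt t / (1 - t)"
    have iPV: "integrable M (\<lambda>\<omega>. \<phi> (V \<omega>) * (P *v V \<omega>) $ i)" for i
      unfolding P_mult_nth
      by (intro Cc_mult_integrable(1)[OF \<phi>] Bochner_Integration.integrable_sum integrable_mult_right V_nth_integrable)
    note iPY = integrable_mult_right[OF P_Y_test(1)[OF \<phi>], of ?c] integrable_mult_right[OF P_Y_test(2)[OF \<phi>], of ?c]
    have eq: "(\<phi> (V \<omega>) *\<^sub>R \<rho> (V \<omega>)) $ i = ?c * (\<phi> (V \<omega>) * (P *v Y \<omega>) $ i) - \<phi> (V \<omega>) * (P *v V \<omega>) $ i"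
      if "\<omega> \<in> space M" for \<omega> i
      unfolding \<rho>[OF that] by (simp add: right_diff_distrib)
    have int: "integrable M (\<lambda>\<omega>. (\<phi> (V \<omega>) *\<^sub>R \<rho> (V \<omega>)) $ i)" for i
      using Bochner_Integration.integrable_diff[OF iPY(1) iPV]
      by (rule Bochner_Integration.integrable_cong[OF refl, THEN iffD1, rotated]) (simp only: eq)
    then show int': "integrable M (\<lambda>\<omega>. \<phi> (V \<omega>) *\<^sub>R \<rho> (V \<omega>))"
      by (subst integrable_vec_iff) blast
    \<comment> \<open>Because \<open>?c * sqrt t + 1\<close> equals 1/(1 - t), the terms in X cancel
      and only a multiple of Z remains.\<close>
    have lin: "?c * (\<phi> (V \<omega>) * (P *v (X \<omega> - sqrt t *\<^sub>R V \<omega>)) $ i) - \<phi> (V \<omega>) * (P *v V \<omega>) $ i =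
        - (1 / sqrt (1 - t)) * (\<phi> (V \<omega>) * (P *v Z \<omega>) $ i)" for \<omega> i
    proof -
      have c: "?c * sqrt t + 1 = 1 / (1 - t)" "?c = (1 / (1 - t)) * sqrt t"
        "1 / (1 - t) * sqrt (1 - t) = 1 / sqrt (1 - t)"
        using t by (simp_all add: field_simps real_sqrt_mult_self)
      have "?c * (x - sqrt t * v) - v = - (1 / sqrt (1 - t)) * z"
        if "v = sqrt t * x + sqrt (1 - t) * z" for x v z
      proof -
        have "?c * (x - sqrt t * v) - v = ?c * x - (?c * sqrt t + 1) * v"
          by (simp only: right_diff_distrib distrib_right mult.assoc mult_1 diff_diff_eq)
        also have "\<dots> = (1 / (1 - t)) * (sqrt t * x - v)"
          unfolding c(1) by (subst c(2)) (simp only: right_diff_distrib mult.assoc)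
        also have "\<dots> = - (1 / (1 - t) * sqrt (1 - t)) * z"
          unfolding that by simp
        finally show ?thesis unfolding c(3) .
      qed
      from this[OF V_nth]
      have "?c *\<^sub>R (X \<omega> - sqrt t *\<^sub>R V \<omega>) - V \<omega> = - (1 / sqrt (1 - t)) *\<^sub>R Z \<omega>"
        by (simp add: vec_eq_iff)
      then have "P *v (?c *\<^sub>R (X \<omega> - sqrt t *\<^sub>R V \<omega>) - V \<omega>) = P *v (- (1 / sqrt (1 - t)) *\<^sub>R Z \<omega>)"
        by simp
      then have "?c * (P *v (X \<omega> - sqrt t *\<^sub>R V \<omega>)) $ i - (P *v V \<omega>) $ i = - (1 / sqrt (1 - t)) * (P *v Z \<omega>) $ i"
        unfolding matrix_vector_mult_diff_distrib[of P "?c *\<^sub>R _"] matrix_vector_mult_scaleR vec_eq_iff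
        by simp
      from arg_cong[OF this, of "\<lambda>x. \<phi> (V \<omega>) * x"] show ?thesis
        by (simp add: algebra_simps)
    qed
    have "expectation (\<lambda>\<omega>. (\<phi> (V \<omega>) *\<^sub>R \<rho> (V \<omega>)) $ i) = - expectation (\<lambda>\<omega>. grad \<phi> (V \<omega>) $ i)" for i
    proof -
      have "expectation (\<lambda>\<omega>. (\<phi> (V \<omega>) *\<^sub>R \<rho> (V \<omega>)) $ i) =
          expectation (\<lambda>\<omega>. ?c * (\<phi> (V \<omega>) * (P *v Y \<omega>) $ i) - \<phi> (V \<omega>) * (P *v V \<omega>) $ i)"
        by (rule Bochner_Integration.integral_cong[OF refl eq])
      also have "\<dots> = expectation (\<lambda>\<omega>. ?c * (\<phi> (V \<omega>) * (P *v (X \<omega> - sqrt t *\<^sub>R V \<omega>)) $ i) - \<phi> (V \<omega>) * (P *v V \<omega>) $ i)"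
        unfolding Bochner_Integration.integral_diff[OF iPY(1) iPV] Bochner_Integration.integral_diff[OF iPY(2) iPV]
          integral_mult_right_zero P_Y_test(3)[OF \<phi>] ..
      also have "\<dots> = - (1 / sqrt (1 - t)) * expectation (\<lambda>\<omega>. \<phi> (V \<omega>) * (P *v Z \<omega>) $ i)"
        unfolding lin integral_mult_right_zero ..
      also have "\<dots> = - expectation (\<lambda>\<omega>. grad \<phi> (V \<omega>) $ i)"
        using t by (simp add: PZ_test[OF \<phi>])
      finally show ?thesis .
    qed
    then show "(\<integral>\<omega>. \<phi> (V \<omega>) *\<^sub>R \<rho> (V \<omega>) \<partial>M) = - (\<integral>\<omega>. grad \<phi> (V \<omega>) \<partial>M)"
      using integral_vec_nth[OF int'] integral_vec_nth[OF Cc_grad_integrable[OF \<phi>]]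
      by (simp add: vec_eq_iff)
  qed
  then show ?thesis
    by (rule that) (simp add: \<rho>)
qed

text \<open>Needed because \<open>J_st\<close> takes an arbitrary score. The integrability contained
  in \<open>is_score\<close>, after multiplication by a test function, is exactly what the
  uniqueness principle asks for.\<close>

lemma score_unique:
  assumes "is_score M V \<rho>" "is_score M V \<rho>'"
  shows "AE \<omega> in M. \<rho> (V \<omega>) = \<rho>' (V \<omega>)"
proof -
  have "AE \<omega> in M. \<rho> (V \<omega>) $ i - \<rho>' (V \<omega>) $ i = 0" for i
  proof (rule V_AE_unique[of "\<lambda>v. \<rho> v $ i - \<rho>' v $ i"])
    show "(\<lambda>v. \<rho> v $ i - \<rho>' v $ i) \<in> borel_measurable borel"
      using assms unfolding is_score_def by (intro borel_measurable_diff) (simp_all add: borel_measurable_vec_iff)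
    fix \<phi> :: "real^'n \<Rightarrow> real" assume "\<phi> \<in> Cc_infinity"
    then have S: "integrable M (\<lambda>\<omega>. \<phi> (V \<omega>) *\<^sub>R \<rho> (V \<omega>))" "integrable M (\<lambda>\<omega>. \<phi> (V \<omega>) *\<^sub>R \<rho>' (V \<omega>))"
      and eq: "(\<integral>\<omega>. \<phi> (V \<omega>) *\<^sub>R \<rho> (V \<omega>) \<partial>M) = (\<integral>\<omega>. \<phi> (V \<omega>) *\<^sub>R \<rho>' (V \<omega>) \<partial>M)"
      using assms by (simp_all add: is_score_def)
    have S': "integrable M (\<lambda>\<omega>. \<phi> (V \<omega>) * \<rho> (V \<omega>) $ i)" "integrable M (\<lambda>\<omega>. \<phi> (V \<omega>) * \<rho>' (V \<omega>) $ i)"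
      using S[THEN integrable_bounded_linear[OF bounded_linear_vec_nth[of i]]] by simp_all
    then show "integrable M (\<lambda>\<omega>. \<phi> (V \<omega>) * (\<rho> (V \<omega>) $ i - \<rho>' (V \<omega>) $ i))"
      by (simp add: right_diff_distrib)
    show "expectation (\<lambda>\<omega>. \<phi> (V \<omega>) * (\<rho> (V \<omega>) $ i - \<rho>' (V \<omega>) $ i)) = 0"
      using eq integral_vec_nth[OF S(1), of i] integral_vec_nth[OF S(2), of i] S'
      by (simp add: right_diff_distrib)
  qed
  then have "AE \<omega> in M. \<forall>i. \<rho> (V \<omega>) $ i - \<rho>' (V \<omega>) $ i = 0"
    by (subst AE_all_countable) blast
  then show ?thesis
    by (rule AE_mp) (simp add: vec_eq_iff)
qed

text \<open>The algebra shared by both claims: the outer C cancels one P, the other P turns (1 - t)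
  C into (1 - t) Id.\<close>

lemma C_P_conjugation:
  "C ** (P ** ((1 - t) *\<^sub>R C - S) ** P) = (1 - t) *\<^sub>R (mat 1 - (1 / (1 - t)) *\<^sub>R (S ** P))"
proof -
  have "C ** (P ** ((1 - t) *\<^sub>R C - S) ** P) = ((1 - t) *\<^sub>R C - S) ** P"
    by (simp add: matrix_mul_assoc C_P)
  also have "\<dots> = (1 - t) *\<^sub>R (C ** P) - S ** P"
    by (simp add: vec_eq_iff matrix_matrix_mult_def left_diff_distrib sum_subtractf sum_distrib_left mult.assoc)
  finally show ?thesis
    using t by (simp add: C_P scaleR_diff_right)
qed

text \<open>The constant is the square of sqrt t / (1 - t) from the explicit score, times 1 - t from
  \<open>C_P_conjugation\<close>.\<close>

lemma J_st_eq:
  assumes "is_score M V \<rho>"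
  shows "J_st M V \<rho> = t / (1 - t) * trace (mat 1 - (1 / (1 - t)) *\<^sub>R (MMSE M X Z t ** P))"
proof -
  obtain \<rho>' where \<rho>': "is_score M V \<rho>'"
    "\<And>\<omega>. \<omega> \<in> space M \<Longrightarrow> \<rho>' (V \<omega>) + P *v V \<omega> = (sqrt t / (1 - t)) *\<^sub>R (P *v Y \<omega>)"
    by (rule score_exists) (rule that)
  have AE: "AE \<omega> in M. vec_sq (\<rho> (V \<omega>) + P *v V \<omega>) = vec_sq ((sqrt t / (1 - t)) *\<^sub>R (P *v Y \<omega>))"
    using score_unique[OF assms \<rho>'(1)] AE_space by eventually_elim (simp add: \<rho>'(2))
  have Ym: "(\<lambda>\<omega>. vec_sq ((sqrt t / (1 - t)) *\<^sub>R (P *v Y \<omega>))) \<in> borel_measurable M"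
  proof -
    have "(\<lambda>\<omega>. Y \<omega> $ k) \<in> borel_measurable M" for k
      using Y_meas borel_measurable_vec_iff by blast
    then show ?thesis
      unfolding borel_measurable_vec_iff by (simp add: vec_sq_def P_mult_nth)
  qed
  have Vm: "(\<lambda>\<omega>. vec_sq (\<rho> (V \<omega>) + P *v V \<omega>)) \<in> borel_measurable M"
  proof -
    have "\<rho> \<in> borel_measurable borel" using assms by (simp add: is_score_def)
    from measurable_compose[OF V_meas this] have "(\<lambda>\<omega>. \<rho> (V \<omega>) $ k) \<in> borel_measurable M" for k
      using borel_measurable_vec_iff[of "\<lambda>\<omega>. \<rho> (V \<omega>)"] by blast
    then show ?thesis
      unfolding borel_measurable_vec_iff by (simp add: vec_sq_def P_mult_nth)
  qed
  have "fisher_info_matrix M V \<rho> = (\<integral>\<omega>. vec_sq ((sqrt t / (1 - t)) *\<^sub>R (P *v Y \<omega>)) \<partial>M)"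
    unfolding fisher_info_matrix_def V_covariance by (rule integral_cong_AE[OF Vm Ym AE])
  also have "\<dots> = (sqrt t / (1 - t))\<^sup>2 *\<^sub>R (P ** ((1 - t) *\<^sub>R C - MMSE M X Z t) ** P)"
    by (rule vec_sq_scaled_P_Y)
  finally have "C ** fisher_info_matrix M V \<rho> =
      (sqrt t / (1 - t))\<^sup>2 *\<^sub>R (C ** (P ** ((1 - t) *\<^sub>R C - MMSE M X Z t) ** P))"
    by (simp add: vec_eq_iff matrix_matrix_mult_def[of C] sum_distrib_left mult.left_commute)
  also have "\<dots> = ((sqrt t / (1 - t))\<^sup>2 * (1 - t)) *\<^sub>R (mat 1 - (1 / (1 - t)) *\<^sub>R (MMSE M X Z t ** P))"
    unfolding C_P_conjugation by simp
  also have "(sqrt t / (1 - t))\<^sup>2 * (1 - t) = t / (1 - t)"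
    using t by (simp add: power_divide power2_eq_square)
  finally show ?thesis
    unfolding J_st_def V_covariance by (simp add: trace_def sum_distrib_left)
qed

section \<open>Integrability of the Stein matrix and the conditional expectation of U\<close>

lemma PZ_nth_borel: "(\<lambda>z. (P *v z) $ i) \<in> borel_measurable borel"
  by (rule measurable_compose[OF _ vec_nth_borel])
    (intro borel_measurable_continuous_onI linear_continuous_on matrix_vector_mul_bounded_linear)

text \<open>A proper subspace is a Lebesgue null set, whereas the density of Z is positive
  everywhere, so a property that holds almost surely for Z holds Lebesgue almost everywhere.\<close>

lemma subspace_full_of_AE:
  assumes T: "subspace T" and AE: "AE z in distr M borel Z. z \<in> T"
  shows "T = UNIV"
proof (rule ccontr)
  assume "T \<noteq> UNIV"
  then have "dim T \<noteq> DIM(real^'n)"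
    using dim_eq_full span_eq_iff T by metis
  then have "dim T < DIM(real^'n)"
    using dim_subset_UNIV[of T] by simp
  then have "T \<in> null_sets lebesgue"
    using negligible_lowdim negligible_iff_null_sets by blast
  from AE_not_in[OF this] have notin: "AE z in lborel. z \<notin> T"
    by (simp add: AE_completion_iff)
  have "distr M borel Z = density lborel (\<lambda>x. ennreal (gaussian_density C x))"
    unfolding distributed_distr_eq_density[OF Z_gaussian, symmetric] by (rule distr_cong) simp_all
  from AE[unfolded this] have "AE z in density lborel (\<lambda>x. ennreal (gaussian_density C x)). z \<in> T" .
  then have "AE z in lborel. 0 < ennreal (gaussian_density C z) \<longrightarrow> z \<in> T"
    using distributed_borel_measurable[OF Z_gaussian] by (subst (asm) AE_density) auto
  then have "AE z in lborel. z \<in> T"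
    by (rule AE_mp) (simp add: gaussian_density_pos)
  with notin have "AE z in lborel :: (real^'n) measure. z \<notin> UNIV"
    by eventually_elim simp
  then have "UNIV \<in> null_sets (lborel :: (real^'n) measure)"
    by (subst AE_iff_null_sets) auto
  then show False by (simp add: null_sets_def)
qed

context
  fixes \<tau> :: "real^'n \<Rightarrow> real^'n^'n"
  assumes stein: "is_stein_matrix M X \<tau>"
    and int: "integrable M (\<lambda>\<omega>. (mat 1 - P ** \<tau> (X \<omega>)) *v (P *v Z \<omega>))"
begin

definition "U \<omega> = (mat 1 - P ** \<tau> (X \<omega>)) *v (P *v Z \<omega>)"

lemma \<tau>_nth_borel: "(\<lambda>x. \<tau> x $ i $ j) \<in> borel_measurable borel"
  using stein unfolding is_stein_matrix_def by (simp add: borel_measurable_vec_iff)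

lemma U_eq: "U \<omega> = P *v Z \<omega> - P *v (\<tau> (X \<omega>) *v (P *v Z \<omega>))"
  by (simp add: U_def matrix_vector_mult_diff_rdistrib matrix_vector_mul_assoc[symmetric])

text \<open>Multiplication by C undoes the outer P, so \<tau>(X) P Z = Z - C U is a difference of
  integrable vectors.\<close>

lemma \<tau>_PZ_integrable: "integrable M (\<lambda>\<omega>. (\<tau> (X \<omega>) *v (P *v Z \<omega>)) $ i)"
proof -
  have eq: "\<tau> (X \<omega>) *v (P *v Z \<omega>) = Z \<omega> - C *v U \<omega>" for \<omega>
    by (simp add: U_eq matrix_vector_mult_diff_distrib C_mult_P_mult)
  have "integrable M (\<lambda>\<omega>. C *v U \<omega>)"
    using integrable_bounded_linear[OF matrix_vector_mul_bounded_linear int] by (simp add: U_def)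
  moreover have "integrable M Z" using Z_nth_integrable integrable_vec_iff by blast
  ultimately have "integrable M (\<lambda>\<omega>. Z \<omega> - C *v U \<omega>)" by simp
  then show ?thesis unfolding eq by (rule integrable_bounded_linear[OF bounded_linear_vec_nth])
qed

text \<open>The \<open>z\<close> for which \<open>\<tau>(X) P z\<close> is integrable form a subspace of full Gaussian measure.\<close>

lemma \<tau>_nth_integrable: "integrable M (\<lambda>\<omega>. \<tau> (X \<omega>) $ i $ j)"
proof -
  define T where "T = {z. \<forall>i. integrable M (\<lambda>\<omega>. (\<tau> (X \<omega>) *v (P *v z)) $ i)}"
  have "subspace T"
    unfolding subspace_def T_def
    by (auto simp: matrix_vector_right_distrib matrix_vector_mult_scaleR)
  moreover have "AE z in distr M borel Z. z \<in> T"
  proof -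
    have "AE z in distr M borel Z. integrable M (\<lambda>\<omega>. (\<tau> (X \<omega>) *v (P *v z)) $ i)" for i
    proof (rule indep_AE_integrable_snd[OF indep _ \<tau>_PZ_integrable])
      show "(\<lambda>(x, z). (\<tau> x *v (P *v z)) $ i) \<in> borel_measurable borel"
        unfolding split_beta matrix_vector_mult_def[of "\<tau> _"] vec_lambda_beta
        by (intro borel_measurable_sum borel_measurable_times fst_snd_borel(1)[OF \<tau>_nth_borel]
            fst_snd_borel(2)[OF PZ_nth_borel])
    qed
    then show ?thesis
      unfolding T_def mem_Collect_eq by (subst AE_all_countable) blast
  qed
  ultimately have "T = UNIV" by (rule subspace_full_of_AE)
  \<comment> \<open>The vector C e_j is chosen so that P maps it to e_j, which extracts the j-th
    column of \<tau>(X).\<close>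
  then have "C *v axis j 1 \<in> T" by simp
  then have "integrable M (\<lambda>\<omega>. (\<tau> (X \<omega>) *v (P *v (C *v axis j 1))) $ i)"
    unfolding T_def by blast
  then show ?thesis
    unfolding P_mult_C_mult unfolding matrix_vector_mult_basis column_def vec_lambda_beta .
qed

text \<open>Integration by parts in Z trades P Z for sqrt (1 - t) times the gradient of \<phi>; the
  Stein identity then trades \<tau>(X) applied to that gradient for X / sqrt t.\<close>

lemma U_test:
  assumes \<phi>: "\<phi> \<in> Cc_infinity"
  shows "expectation (\<lambda>\<omega>. \<phi> (V \<omega>) * U \<omega> $ i) =
    expectation (\<lambda>\<omega>. \<phi> (V \<omega>) * (P *v Z \<omega>) $ i) -
    sqrt (1 - t) / sqrt t * (\<Sum>k\<in>UNIV. P $ i $ k * expectation (\<lambda>\<omega>. \<phi> (V \<omega>) * X \<omega> $ k))"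
proof -
  \<comment> \<open>The integrability of U controls only the sum over j. Single terms are integrable
    by independence, as products of integrable functions of X and of Z.\<close>
  have i\<tau>: "integrable M (\<lambda>\<omega>. \<phi> (V \<omega>) * (\<tau> (X \<omega>) $ k $ j * (P *v Z \<omega>) $ j))" for k j
    by (intro Cc_mult_integrable(1)[OF \<phi>]
        indep_var_integrable[OF indep_real[OF \<tau>_nth_borel PZ_nth_borel] \<tau>_nth_integrable PZ_integrable])
  have iPZ: "integrable M (\<lambda>\<omega>. \<phi> (V \<omega>) * (P *v Z \<omega>) $ i)"
    by (intro Cc_mult_integrable(1)[OF \<phi>] PZ_integrable)
  let ?s = "\<lambda>\<omega> k. \<Sum>j\<in>UNIV. \<phi> (V \<omega>) * (\<tau> (X \<omega>) $ k $ j * (P *v Z \<omega>) $ j)"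
  have iS: "integrable M (\<lambda>\<omega>. P $ i $ k * ?s \<omega> k)" for k
    by (intro integrable_mult_right Bochner_Integration.integrable_sum i\<tau>)
  have Es: "expectation (\<lambda>\<omega>. ?s \<omega> k) = sqrt (1 - t) / sqrt t * expectation (\<lambda>\<omega>. \<phi> (V \<omega>) * X \<omega> $ k)" for k
  proof -
    have "expectation (\<lambda>\<omega>. ?s \<omega> k) = (\<Sum>j\<in>UNIV. expectation (\<lambda>\<omega>. \<phi> (V \<omega>) * (\<tau> (X \<omega>) $ k $ j * (P *v Z \<omega>) $ j)))"
      by (rule Bochner_Integration.integral_sum[OF i\<tau>])
    also have "\<dots> = sqrt (1 - t) * (\<Sum>j\<in>UNIV. expectation (\<lambda>\<omega>. grad \<phi> (V \<omega>) $ j * \<tau> (X \<omega>) $ k $ j))"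
      by (simp only: weighted_ibp[OF \<tau>_nth_borel \<tau>_nth_integrable \<phi>] sum_distrib_left)
    finally show ?thesis
      using t by (simp add: stein_shift[OF stein \<tau>_nth_integrable \<phi>, symmetric])
  qed
  have eq: "\<phi> (V \<omega>) * U \<omega> $ i = \<phi> (V \<omega>) * (P *v Z \<omega>) $ i - (\<Sum>k\<in>UNIV. P $ i $ k * ?s \<omega> k)" for \<omega>
  proof -
    have "\<phi> (V \<omega>) * (P *v (\<tau> (X \<omega>) *v (P *v Z \<omega>))) $ i = (\<Sum>k\<in>UNIV. P $ i $ k * ?s \<omega> k)"
      unfolding P_mult_nth[of _ i] matrix_vector_mult_def[of "\<tau> _"] vec_lambda_beta
      by (simp only: sum_distrib_left mult.left_commute)
    then show ?thesis by (simp only: U_eq vector_minus_component right_diff_distrib)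
  qed
  have "expectation (\<lambda>\<omega>. \<phi> (V \<omega>) * U \<omega> $ i) = expectation (\<lambda>\<omega>. \<phi> (V \<omega>) * (P *v Z \<omega>) $ i) -
      (\<Sum>k\<in>UNIV. P $ i $ k * expectation (\<lambda>\<omega>. ?s \<omega> k))"
    unfolding eq Bochner_Integration.integral_diff[OF iPZ Bochner_Integration.integrable_sum[OF iS]]
      Bochner_Integration.integral_sum[OF iS] integral_mult_right_zero ..
  then show ?thesis
    by (simp only: Es sum_distrib_left mult.left_commute)
qed

text \<open>After testing, U acts like P (Z - r X) with r = sqrt (1 - t) / sqrt t, and Y acts like X
  - sqrt t V = (1 - t) X - sqrt t sqrt (1 - t) Z. These two vectors are proportional up to the outer
  P.\<close>

lemma cond_exp_U:
  "AE \<omega> in M. vec_cond_exp M V U \<omega> = (- (1 / (sqrt t * sqrt (1 - t)))) *\<^sub>R (P *v Y \<omega>)"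
proof -
  \<comment> \<open>This factor makes the coefficient of Z in c (X - sqrt t V) equal to 1.\<close>
  define c where "c = - (1 / (sqrt t * sqrt (1 - t)))"
  obtain u where u: "u \<in> borel_measurable borel" "\<forall>\<omega>\<in>space M. EXV \<omega> = u (V \<omega>)"
    using vec_cond_exp_factor[of X] by blast
  obtain w where w: "w \<in> borel_measurable borel" "\<forall>\<omega>\<in>space M. vec_cond_exp M V U \<omega> = w (V \<omega>)"
    using vec_cond_exp_factor[of U] by blast
  \<comment> \<open>Both sides are written through their Borel factors, since uniqueness concerns
    functions on the range space of V.\<close>
  define h where "h i v = w v $ i - c * (P *v (u v - sqrt t *\<^sub>R v)) $ i" for i v
  have h: "h i (V \<omega>) = vec_cond_exp M V U \<omega> $ i - c * (P *v Y \<omega>) $ i" if "\<omega> \<in> space M" for i \<omega>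
    using u(2) w(2) that by (simp add: h_def Y_def)
  have "AE \<omega> in M. h i (V \<omega>) = 0" for i
  proof (rule V_AE_unique)
    show "h i \<in> borel_measurable borel"
      unfolding h_def[abs_def]
      by (intro borel_measurable_diff borel_measurable_times borel_measurable_const
          measurable_compose[OF _ PZ_nth_borel] measurable_compose[OF w(1) vec_nth_borel] u(1)
          borel_measurable_scaleR) auto
    fix \<phi> :: "real^'n \<Rightarrow> real" assume \<phi>: "\<phi> \<in> Cc_infinity"
    have Ui: "integrable M (\<lambda>\<omega>. U \<omega> $ i)"
      using integrable_bounded_linear[OF bounded_linear_vec_nth int] by (simp add: U_def)
    note E = vec_cond_exp_test[OF Cc_infinity_borel[OF \<phi>] borel_measurable_integrable[OF Ui]
        Cc_mult_integrable(1)[OF \<phi> Ui]]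
    note iY = integrable_mult_right[OF P_Y_test(1)[OF \<phi>], of c i]
    note d = Bochner_Integration.integrable_diff[OF E(1) iY]
    have eq: "\<phi> (V \<omega>) * h i (V \<omega>) = \<phi> (V \<omega>) * vec_cond_exp M V U \<omega> $ i - c * (\<phi> (V \<omega>) * (P *v Y \<omega>) $ i)"
      if "\<omega> \<in> space M" for \<omega>
      by (simp add: h[OF that] right_diff_distrib)
    show "integrable M (\<lambda>\<omega>. \<phi> (V \<omega>) * h i (V \<omega>))"
      using d by (rule Bochner_Integration.integrable_cong[OF refl, THEN iffD1, rotated]) (simp only: eq)
    have "expectation (\<lambda>\<omega>. \<phi> (V \<omega>) * h i (V \<omega>)) =
        expectation (\<lambda>\<omega>. \<phi> (V \<omega>) * vec_cond_exp M V U \<omega> $ i - c * (\<phi> (V \<omega>) * (P *v Y \<omega>) $ i))"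
      by (rule Bochner_Integration.integral_cong[OF refl eq])
    also have "\<dots> = expectation (\<lambda>\<omega>. \<phi> (V \<omega>) * U \<omega> $ i) -
        c * expectation (\<lambda>\<omega>. \<phi> (V \<omega>) * (P *v (X \<omega> - sqrt t *\<^sub>R V \<omega>)) $ i)"
      unfolding Bochner_Integration.integral_diff[OF E(1) iY] E(2) integral_mult_right_zero P_Y_test(3)[OF \<phi>] ..
    also have "c * expectation (\<lambda>\<omega>. \<phi> (V \<omega>) * (P *v (X \<omega> - sqrt t *\<^sub>R V \<omega>)) $ i) =
        expectation (\<lambda>\<omega>. \<phi> (V \<omega>) * U \<omega> $ i)"
    proof -
      let ?r = "sqrt (1 - t) / sqrt t"
      have c: "c * (x - sqrt t * (sqrt t * x + sqrt (1 - t) * z)) = z - ?r * x" for x z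
      proof -
        have "sqrt t * sqrt t = t" "sqrt (1 - t) * sqrt (1 - t) = 1 - t" using t by simp_all
        then have "x - sqrt t * (sqrt t * x + sqrt (1 - t) * z) =
            sqrt (1 - t) * (sqrt (1 - t) * x) - sqrt t * (sqrt (1 - t) * z)"
          by (metis (no_types, opaque_lifting) add_diff_cancel_left' diff_add_eq_diff_diff_swap
              diff_diff_eq left_diff_distrib mult.assoc mult_1 distrib_left add.commute)
        then show ?thesis
          using t by (simp add: c_def field_simps)
      qed
      have "c *\<^sub>R (X \<omega> - sqrt t *\<^sub>R V \<omega>) = Z \<omega> - ?r *\<^sub>R X \<omega>" for \<omega>
        using c by (simp add: vec_eq_iff V_nth)
      then have "P *v (c *\<^sub>R (X \<omega> - sqrt t *\<^sub>R V \<omega>)) = P *v (Z \<omega> - ?r *\<^sub>R X \<omega>)" for \<omega>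
        by simp
      then have "c * (P *v (X \<omega> - sqrt t *\<^sub>R V \<omega>)) $ i = (P *v Z \<omega>) $ i - ?r * (P *v X \<omega>) $ i" for \<omega>
        unfolding matrix_vector_mult_diff_distrib[of P "Z _"] matrix_vector_mult_scaleR vec_eq_iff by simp
      then have pt: "c * (\<phi> (V \<omega>) * (P *v (X \<omega> - sqrt t *\<^sub>R V \<omega>)) $ i) =
          \<phi> (V \<omega>) * (P *v Z \<omega>) $ i - ?r * (\<Sum>k\<in>UNIV. P $ i $ k * (\<phi> (V \<omega>) * X \<omega> $ k))" for \<omega>
      proof -
        have "(\<Sum>k\<in>UNIV. P $ i $ k * (\<phi> (V \<omega>) * X \<omega> $ k)) = \<phi> (V \<omega>) * (P *v X \<omega>) $ i"
          by (simp add: P_mult_nth sum_distrib_left mult.left_commute)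
        then show ?thesis
          using \<open>c * (P *v (X \<omega> - sqrt t *\<^sub>R V \<omega>)) $ i = _\<close>
          by (simp only: mult.left_commute[of c] mult.left_commute[of ?r] right_diff_distrib)
      qed
      have iPZ: "integrable M (\<lambda>\<omega>. \<phi> (V \<omega>) * (P *v Z \<omega>) $ i)"
        by (intro Cc_mult_integrable(1)[OF \<phi>] PZ_integrable)
      have iX: "integrable M (\<lambda>\<omega>. P $ i $ k * (\<phi> (V \<omega>) * X \<omega> $ k))" for k
        by (intro integrable_mult_right Cc_mult_integrable(1)[OF \<phi>] X_nth_integrable)
      have "c * expectation (\<lambda>\<omega>. \<phi> (V \<omega>) * (P *v (X \<omega> - sqrt t *\<^sub>R V \<omega>)) $ i) =
          expectation (\<lambda>\<omega>. \<phi> (V \<omega>) * (P *v Z \<omega>) $ i - ?r * (\<Sum>k\<in>UNIV. P $ i $ k * (\<phi> (V \<omega>) * X \<omega> $ k)))"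
        unfolding integral_mult_right_zero[symmetric] pt ..
      also have "\<dots> = expectation (\<lambda>\<omega>. \<phi> (V \<omega>) * (P *v Z \<omega>) $ i) -
          ?r * (\<Sum>k\<in>UNIV. P $ i $ k * expectation (\<lambda>\<omega>. \<phi> (V \<omega>) * X \<omega> $ k))"
        unfolding Bochner_Integration.integral_diff[OF iPZ integrable_mult_right[OF Bochner_Integration.integrable_sum[OF iX]]]
          integral_mult_right_zero Bochner_Integration.integral_sum[OF iX] ..
      also have "\<dots> = expectation (\<lambda>\<omega>. \<phi> (V \<omega>) * U \<omega> $ i)"
        by (rule U_test[OF \<phi>, symmetric])
      finally show ?thesis .
    qed
    finally show "expectation (\<lambda>\<omega>. \<phi> (V \<omega>) * h i (V \<omega>)) = 0" by simp
  qed
  then have "AE \<omega> in M. \<forall>i. h i (V \<omega>) = 0"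
    by (subst AE_all_countable) blast
  with AE_space show ?thesis
    unfolding c_def[symmetric] by eventually_elim (simp add: h vec_eq_iff)
qed

text \<open>The factor t normalises: the squared constant of \<open>cond_exp_U\<close> is 1/(t (1 -
  t)), and the conjugation by P supplies the remaining 1 - t.\<close>

lemma MMSE_identity:
  "mat 1 - (1 / (1 - t)) *\<^sub>R (MMSE M X Z t ** P) =
    t *\<^sub>R (C ** (\<integral>\<omega>. vec_sq (vec_cond_exp M V U \<omega>) \<partial>M))"
proof -
  let ?c = "- (1 / (sqrt t * sqrt (1 - t)))"
  have "(\<integral>\<omega>. vec_sq (vec_cond_exp M V U \<omega>) \<partial>M) = (\<integral>\<omega>. vec_sq (?c *\<^sub>R (P *v Y \<omega>)) \<partial>M)"
  proof (rule integral_cong_AE)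
    show "(\<lambda>\<omega>. vec_sq (vec_cond_exp M V U \<omega>)) \<in> borel_measurable M"
      unfolding borel_measurable_vec_iff by (simp add: vec_sq_def vec_cond_exp_def)
    have "(\<lambda>\<omega>. Y \<omega> $ k) \<in> borel_measurable M" for k
      using Y_meas borel_measurable_vec_iff by blast
    then show "(\<lambda>\<omega>. vec_sq (?c *\<^sub>R (P *v Y \<omega>))) \<in> borel_measurable M"
      unfolding borel_measurable_vec_iff by (simp add: vec_sq_def P_mult_nth)
    show "AE \<omega> in M. vec_sq (vec_cond_exp M V U \<omega>) = vec_sq (?c *\<^sub>R (P *v Y \<omega>))"
      using cond_exp_U by eventually_elim simp
  qed
  then have "C ** (\<integral>\<omega>. vec_sq (vec_cond_exp M V U \<omega>) \<partial>M) =
      ?c\<^sup>2 *\<^sub>R (C ** (P ** ((1 - t) *\<^sub>R C - MMSE M X Z t) ** P))"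
    unfolding vec_sq_scaled_P_Y
    by (simp add: vec_eq_iff matrix_matrix_mult_def[of C] sum_distrib_left mult.left_commute)
  then have "t *\<^sub>R (C ** (\<integral>\<omega>. vec_sq (vec_cond_exp M V U \<omega>) \<partial>M)) =
      (t * (?c\<^sup>2 * (1 - t))) *\<^sub>R (mat 1 - (1 / (1 - t)) *\<^sub>R (MMSE M X Z t ** P))"
    unfolding C_P_conjugation by simp
  moreover have "t * (?c\<^sup>2 * (1 - t)) = 1"
    using t by (simp add: power_divide power_mult_distrib)
  ultimately show ?thesis by simp
qed

end

end

theorem mainTheorem3:
  fixes M :: "'a measure"
    and X Z :: "'a \<Rightarrow> real^'n"
    and f :: "real^'n \<Rightarrow> ennreal"
    and C :: "real^'n^'n"
    and \<tau> :: "real^'n \<Rightarrow> real^'n^'n"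
    and t :: real
  assumes "prob_space M"
    and X_density: "distributed M lborel X f"
    and X_square_integrable: "integrable M (\<lambda>\<omega>. (norm (X \<omega>))\<^sup>2)"
    and X_centered: "(\<integral>\<omega>. X \<omega> \<partial>M) = 0"
    and X_covariance: "covariance_matrix M X = C"
    and C_invertible: "invertible C"
    and X_stein: "is_stein_matrix M X \<tau>"
    and Z_gaussian: "distributed M lborel Z (\<lambda>x. ennreal (gaussian_density C x))"
    and X_Z_indep: "prob_space.indep_var M borel X borel Z"
    and t_bounds: "0 < t" "t < 1"
  shows "(integrable M (\<lambda>\<omega>. (mat 1 - matrix_inv C ** \<tau> (X \<omega>)) *v (matrix_inv C *v Z \<omega>)) \<longrightarrow>
           mat 1 - (1 / (1 - t)) *\<^sub>R (MMSE M X Z t ** matrix_inv C) =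
           t *\<^sub>R (C ** (\<integral>\<omega>. vec_sq (vec_cond_exp M (interp X Z t)
             (\<lambda>\<omega>'. (mat 1 - matrix_inv C ** \<tau> (X \<omega>')) *v (matrix_inv C *v Z \<omega>')) \<omega>) \<partial>M)))
       \<and> (\<exists>\<rho>. is_score M (interp X Z t) \<rho>)
       \<and> (\<forall>\<rho>. is_score M (interp X Z t) \<rho> \<longrightarrow>
           J_st M (interp X Z t) \<rho> =
           t / (1 - t) * trace (mat 1 - (1 / (1 - t)) *\<^sub>R (MMSE M X Z t ** matrix_inv C)))"
proof -
  interpret prob_space M by fact
  have "X \<in> borel_measurable M"
    using distributed_measurable[OF X_density] by simp
  then interpret gaussian_channel M X Z C t
    using X_square_integrable X_centered X_covariance C_invertible Z_gaussian X_Z_indep t_bounds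
    by unfold_locales
  show ?thesis
  proof (intro conjI impI allI)
    assume int: "integrable M (\<lambda>\<omega>. (mat 1 - matrix_inv C ** \<tau> (X \<omega>)) *v (matrix_inv C *v Z \<omega>))"
    note * = MMSE_identity[OF X_stein int]
    \<comment> \<open>Outside its context \<open>U\<close> takes \<tau> as an argument, and its
      defining equation carries the assumptions of that context.\<close>
    have "U \<tau> = (\<lambda>\<omega>'. (mat 1 - matrix_inv C ** \<tau> (X \<omega>')) *v (matrix_inv C *v Z \<omega>'))"
      by (intro ext U_def[OF X_stein int])
    with * show "mat 1 - (1 / (1 - t)) *\<^sub>R (MMSE M X Z t ** matrix_inv C) =
        t *\<^sub>R (C ** (\<integral>\<omega>. vec_sq (vec_cond_exp M (interp X Z t)
          (\<lambda>\<omega>'. (mat 1 - matrix_inv C ** \<tau> (X \<omega>')) *v (matrix_inv C *v Z \<omega>')) \<omega>) \<partial>M))"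
      by (simp only:)
  next
    show "\<exists>\<rho>. is_score M (interp X Z t) \<rho>"
      by (rule score_exists) blast
  next
    fix \<rho> assume "is_score M (interp X Z t) \<rho>"
    then show "J_st M (interp X Z t) \<rho> =
        t / (1 - t) * trace (mat 1 - (1 / (1 - t)) *\<^sub>R (MMSE M X Z t ** matrix_inv C))"
      by (rule J_st_eq)
  qed
qed

end
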